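(* Let $\mu$ be a compactly supported absolutely continuous (with respect to Lebesgue measure) probability measure on $\mathbb{R}^n$ with $d\mu(x)=\varphi(x)\,dx$, and let $K$ be its support. Then $L^2(K,d\mu)$ admits a Fourier frame if and only if there exist positive constants $m,M$ such that $m\le\varphi(x)\le M$ (Lebesgue-)almost everywhere on the support $K$ of $\mu$.
   Context: The support $K$ of $\mu$ is the usual (closed) support, i.e. the smallest closed set of full $\mu$-measure; it is compact here. $L^2(K,d\mu)$ denotes the $L^2$ space of the measure $\mu$ with support $K$. A sequence of vectors $\{e_i\}$ in a Hilbert space $H$ is a frame if there exist constants $A,B>0$ such that $A\|f\|^2\le\sum_i|\langle f,e_i\rangle|^2\le B\|f\|^2$ for all $f\in H$. $L^2(K,d\mu)$ admits a Fourier frame if there is a countable set $\Lambda\subset\mathbb{R}^n$ such that the complex exponentials $\{e^{2\pi i\langle\lambda,\cdot\rangle}\}_{\lambda\in\Lambda}$ form a frame of $L^2(K,d\mu)$, i.e. there are $A,B>0$ with $$A\int|f|^2d\mu\le\sum_{\lambda\in\Lambda}\Big|\int f(x)e^{-2\pi i\langle\lambda,x\rangle}d\mu(x)\Big|^2\le B\int|f|^2d\mu$$ for all $f\in L^2(K,d\mu)$.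
   Formalization: The bounds m ≤ φ ≤ M are required only at almost every point of K where φ ≠ 0, since with the closed support the claim as written fails (φ twice the indicator of an open dense subset of the unit cube of measure 1/2). *)

theory Defs
  imports "HOL-Probability.Probability"
begin

definition msupport :: "'a::topological_space measure \<Rightarrow> 'a set" where
  "msupport \<mu> = \<Inter>{F. closed F \<and> emeasure \<mu> (- F) = 0}"

text \<open>Pitfall: for \<open>\<mu> = density lborel \<phi>\<close> the closed support can exceed \<open>{x. \<phi> x \<noteq> 0}\<close> by a set of
  positive Lebesgue measure. Let \<open>U\<close> be open and dense in the unit interval with Lebesgue measure
  \<open>1/2\<close>, and let \<open>\<phi>\<close> be twice the indicator of \<open>U\<close>. The support is the whole interval, the integer
  frequencies form a tight Fourier frame of \<open>L\<^sup>2(U)\<close>, and yet \<open>\<phi> = 0\<close> on a subset of the support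
  of measure \<open>1/2\<close>. Hence a bound of the form \<open>m \<le> \<phi>\<close> with \<open>m > 0\<close> can characterise Fourier frames
  only on the part of the support where \<open>\<phi>\<close> does not vanish.\<close>

lemma closed_msupport: "closed (msupport \<mu>)"
  unfolding msupport_def by (auto intro: closed_Inter)

lemma msupport_least: "closed F \<Longrightarrow> emeasure \<mu> (- F) = 0 \<Longrightarrow> msupport \<mu> \<subseteq> F"
  unfolding msupport_def by auto

lemma emeasure_compl_msupport:
  fixes \<mu> :: "'a::second_countable_topology measure"
  assumes "sets \<mu> = sets borel"
  shows "emeasure \<mu> (- msupport \<mu>) = 0"
proof -
  let ?U = "{U. open U \<and> emeasure \<mu> U = 0}"
  have eq: "- msupport \<mu> = \<Union>?U"
  proof (intro equalityI subsetI)
    fix x assume "x \<in> - msupport \<mu>"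
    then show "x \<in> \<Union>?U" by (auto simp: msupport_def open_Compl)
  next
    fix x assume "x \<in> \<Union>?U"
    then obtain U where "open U" "emeasure \<mu> U = 0" "x \<in> U" by auto
    then show "x \<in> - msupport \<mu>"
      using msupport_least[of "- U" \<mu>] by (auto simp: closed_Compl)
  qed
  obtain \<V> where V: "\<V> \<subseteq> ?U" "countable \<V>" "\<Union>\<V> = \<Union>?U"
    using Lindelof[of ?U] by auto
  have "(\<Union>U\<in>\<V>. U) \<in> null_sets \<mu>"
  proof (rule null_sets_UN'[OF V(2)])
    fix U assume "U \<in> \<V>"
    then have "open U" "emeasure \<mu> U = 0"
      using V(1) by auto
    then show "U \<in> null_sets \<mu>"
      using assms by (intro null_setsI) simp_all
  qed
  then have "- msupport \<mu> \<in> null_sets \<mu>"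
    unfolding eq using V(3) by simp
  then show ?thesis
    by (rule null_setsD1)
qed

text \<open>Functions stand for their classes modulo equality \<open>\<mu>\<close>-almost everywhere. The complement of
  the support is \<open>\<mu>\<close>-null, so \<open>L2 \<mu>\<close> and \<open>L\<^sup>2(K, d\<mu>)\<close> for \<open>K = msupport \<mu>\<close> are the same space.\<close>

definition L2 :: "'a measure \<Rightarrow> ('a \<Rightarrow> complex) set" where
  "L2 \<mu> = {f \<in> borel_measurable \<mu>. integrable \<mu> (\<lambda>x. (norm (f x))\<^sup>2)}"

text \<open>For a finite measure \<open>\<mu>\<close> and \<open>f \<in> L2 \<mu>\<close>, the integral below is the inner product of \<open>f\<close> with
  \<open>x \<mapsto> exp (2 \<pi> i \<langle>l, x\<rangle>)\<close>.\<close>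

definition fourier_coeff :: "(real ^ 'n) measure \<Rightarrow> (real ^ 'n \<Rightarrow> complex) \<Rightarrow> real ^ 'n \<Rightarrow> complex" where
  "fourier_coeff \<mu> f l =
     integral\<^sup>L \<mu> (\<lambda>x. f x * exp (- 2 * complex_of_real pi * \<i> * complex_of_real (l \<bullet> x)))"

text \<open>Summability is required explicitly because \<open>infsum\<close> of a divergent family is \<open>0\<close>.\<close>

definition is_fourier_frame :: "(real ^ 'n) measure \<Rightarrow> (real ^ 'n) set \<Rightarrow> bool" where
  "is_fourier_frame \<mu> \<Lambda> \<longleftrightarrow> (\<exists>A>0. \<exists>B>0. \<forall>f\<in>L2 \<mu>.
      (\<lambda>l. (norm (fourier_coeff \<mu> f l))\<^sup>2) summable_on \<Lambda> \<and>
      A * (\<integral>x. (norm (f x))\<^sup>2 \<partial>\<mu>) \<le> (\<Sum>\<^sub>\<infinity>l\<in>\<Lambda>. (norm (fourier_coeff \<mu> f l))\<^sup>2) \<and>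
      (\<Sum>\<^sub>\<infinity>l\<in>\<Lambda>. (norm (fourier_coeff \<mu> f l))\<^sup>2) \<le> B * (\<integral>x. (norm (f x))\<^sup>2 \<partial>\<mu>))"

definition admits_fourier_frame :: "(real ^ 'n) measure \<Rightarrow> bool" where
  "admits_fourier_frame \<mu> \<longleftrightarrow> (\<exists>\<Lambda>. countable \<Lambda> \<and> is_fourier_frame \<mu> \<Lambda>)"

end

theory Submission
  imports Defs
begin

text \<open>
Write \<open>g\<close> for \<open>\<phi> f\<close> and \<open>P(l)\<close> for \<open>\<bar>fourier g l\<bar>\<^sup>2\<close>. The Fourier coefficients of \<open>f\<close>
with respect to \<open>\<mu>\<close> are the values of the ordinary Fourier transform of \<open>g\<close>, so a frame compares a sum
of values of \<open>P\<close> over \<open>\<Lambda>\<close> with \<open>\<integral>\<bar>f\<bar>\<^sup>2 d\<mu>\<close>, whereas Plancherel relates \<open>P\<close> to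
\<open>\<integral>\<bar>g\<bar>\<^sup>2 dx\<close>. Since \<open>\<bar>g\<bar>\<^sup>2 = \<phi> (\<phi> \<bar>f\<bar>\<^sup>2)\<close>, the quotient of the two integrals is an average
of \<open>\<phi>\<close>, and the theorem says that these averages stay between positive bounds exactly when a
frame exists.

If \<open>m \<le> \<phi> \<le> M\<close> where \<open>\<phi>\<close> does not vanish, take for \<open>\<Lambda>\<close> the lattice dual to a cube that contains the
support. Parseval's identity on the cube (\<open>has_sum_fourier_lattice\<close>) turns the sum over \<open>\<Lambda>\<close> into a
multiple of \<open>\<integral>\<bar>g\<bar>\<^sup>2 dx\<close>, and this lies between \<open>m \<integral>\<bar>f\<bar>\<^sup>2 d\<mu>\<close> and \<open>M \<integral>\<bar>f\<bar>\<^sup>2 d\<mu>\<close>.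
Completeness of the characters is reduced to polynomial approximation: wrapping the cube around a torus turns
polynomials in the coordinates of the torus into trigonometric polynomials.

Conversely, let \<open>\<Lambda>\<close> give a frame with bounds \<open>A\<close> and \<open>B\<close>. Multiplying \<open>f\<close> by a character translates
\<open>P\<close> and leaves \<open>\<integral>\<bar>f\<bar>\<^sup>2 d\<mu>\<close> unchanged, so the frame inequalities hold for the sums of all translates of \<open>P\<close>
over \<open>\<Lambda>\<close>. Averaged over translations, such a sum measures the total mass of \<open>P\<close> times a density of \<open>\<Lambda>\<close>
that is the same for all functions. Hence two functions \<open>f\<close> and \<open>f'\<close> can be compared without
knowing that density (\<open>translate_sum_comparison\<close>): with \<open>g'\<close> for \<open>\<phi> f'\<close>, Plancherel gives, for bounded
\<open>g\<close> and \<open>g'\<close>,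

\<open>A \<integral>\<bar>f\<bar>\<^sup>2 d\<mu> \<integral>\<bar>g'\<bar>\<^sup>2 dx \<le> B \<integral>\<bar>f'\<bar>\<^sup>2 d\<mu> \<integral>\<bar>g\<bar>\<^sup>2 dx\<close>.

For indicators of level sets this reads \<open>A t \<le> B s\<close> whenever \<open>\<phi>\<close> takes positive values up to \<open>s\<close> and
values from \<open>t\<close> on, each on a set of positive \<open>\<mu>\<close>-measure (\<open>frame_level_set_comparison\<close>). So the essential
supremum of \<open>\<phi>\<close> is at most \<open>B / A\<close> times its essential infimum on the set where it does not vanish.
\<close>

section \<open>Characters and their orthogonality on a cube\<close>

definition character :: "real ^ 'n \<Rightarrow> real ^ 'n \<Rightarrow> complex" where
  "character l x = cis (2 * pi * (l \<bullet> x))"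

definition fourier :: "(real ^ 'n \<Rightarrow> complex) \<Rightarrow> real ^ 'n \<Rightarrow> complex" where
  "fourier g l = (\<integral>x. g x * cnj (character l x) \<partial>lborel)"

lemma measurable_cnj [measurable]: "cnj \<in> borel_measurable borel"
  by (intro borel_measurable_continuous_onI continuous_intros)

lemma norm_character [simp]: "norm (character l x) = 1"
  by (simp add: character_def)

lemma character_0 [simp]: "character 0 x = 1"
  by (simp add: character_def)

lemma character_add: "character (l + m) x = character l x * character m x"
  by (simp add: character_def cis_mult algebra_simps)

lemma character_minus: "character (- l) x = cnj (character l x)"
  by (simp add: character_def cis_cnj)

lemma continuous_character [continuous_intros]: "continuous_on S (character l)"
  unfolding character_def[abs_def] by (intro continuous_intros)

lemma measurable_character [measurable]: "character l \<in> borel_measurable borel"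
  by (intro borel_measurable_continuous_onI continuous_character)

definition lattice_point :: "real \<Rightarrow> int ^ 'n \<Rightarrow> real ^ 'n" where
  "lattice_point L k = (\<chi> i. of_int (k $ i) / L)"

lemma lattice_point_add: "lattice_point L (j + k) = lattice_point L j + lattice_point L k"
  by (simp add: lattice_point_def vec_eq_iff add_divide_distrib)

lemma lattice_point_diff: "lattice_point L (j - k) = lattice_point L j - lattice_point L k"
  by (simp add: lattice_point_def vec_eq_iff diff_divide_distrib)

definition cube :: "real \<Rightarrow> (real ^ 'n) set" where
  "cube L = {x. \<forall>i. \<bar>x $ i\<bar> < L / 2}"

lemma cube_eq_box: "(cube L :: (real ^ 'n) set) = box (\<chi> i. - (L / 2)) (\<chi> i. L / 2)"
proof -
  have "\<bar>t\<bar> < L / 2 \<longleftrightarrow> - (L / 2) < t \<and> t < L / 2" for t by linarith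
  then show ?thesis by (simp only: cube_def set_eq_iff mem_box_cart mem_Collect_eq vec_lambda_beta) simp
qed

lemma open_cube [simp]: "open (cube L)"
  unfolding cube_eq_box by (rule open_box)

lemma cube_borel [measurable]: "cube L \<in> sets borel"
  by (simp add: borel_open)

lemma emeasure_cube:
  assumes "L > 0"
  shows "emeasure lborel (cube L :: (real ^ 'n) set) = ennreal (L ^ CARD('n))"
proof -
  have *: "b \<in> Basis \<Longrightarrow> (\<chi> i. c) \<bullet> b = c" for b :: "real ^ 'n" and c :: real
    by (auto simp: Basis_vec_def inner_axis)
  have "(\<Prod>b\<in>Basis. ((\<chi> i. L/2) - (\<chi> i. - (L/2)) :: real ^ 'n) \<bullet> b) = (\<Prod>b\<in>(Basis :: (real ^ 'n) set). L)"
    by (intro prod.cong) (auto simp: inner_diff_left *)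
  then show ?thesis
    unfolding cube_eq_box using assms
    by (subst emeasure_lborel_box) (auto simp: *)
qed

lemma integral_lborel_prod:
  fixes f :: "'a::euclidean_space \<Rightarrow> real \<Rightarrow> 'b::{real_normed_field,banach,second_countable_topology}"
  assumes int: "\<And>b. b \<in> Basis \<Longrightarrow> integrable lborel (f b)"
  shows "(\<integral>x. (\<Prod>b\<in>Basis. f b (x \<bullet> b)) \<partial>lborel) = (\<Prod>b\<in>Basis. (\<integral>t. f b t \<partial>lborel))"
proof -
  interpret product_sigma_finite "\<lambda>_::'a. lborel :: real measure" ..
  have m [measurable]: "f b \<in> borel_measurable borel" if "b \<in> Basis" for b
    using int[OF that] by auto
  have "(\<integral>x. (\<Prod>b\<in>Basis. f b (x \<bullet> b)) \<partial>lborel) =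
    (\<integral>y. (\<Prod>b\<in>Basis. f b ((\<Sum>c\<in>Basis. y c *\<^sub>R c) \<bullet> b)) \<partial>(\<Pi>\<^sub>M b\<in>(Basis::'a set). lborel))"
    by (subst lborel_eq, subst integral_distr) auto
  also have "\<dots> = (\<integral>y. (\<Prod>b\<in>Basis. f b (y b)) \<partial>(\<Pi>\<^sub>M b\<in>(Basis::'a set). lborel))"
    by (intro Bochner_Integration.integral_cong refl prod.cong) auto
  also have "\<dots> = (\<Prod>b\<in>Basis. (\<integral>t. f b t \<partial>lborel))"
    by (intro product_integral_prod int) auto
  finally show ?thesis .
qed

text \<open>The antiderivative \<open>cis (a t) / (\<i> a)\<close> for \<open>a = 2 \<pi> m / L\<close> has \<open>L\<close> as a period, so it takes
equal values at both ends of the interval.\<close>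

lemma integral_cis_period:
  fixes m :: int
  assumes L: "L > 0" and m: "m \<noteq> 0"
  shows "(\<integral>t. indicator {-(L/2)<..<L/2} t *\<^sub>R cis (2 * pi * (m / L * t)) \<partial>lborel) = 0"
proof -
  define a where "a = 2 * pi * (m / L)"
  have a: "a \<noteq> 0" using L m by (simp add: a_def)
  let ?F = "\<lambda>t. cis (a * t) / (\<i> * a)"
  have [measurable]: "(\<lambda>t. cis (c * t)) \<in> borel_measurable borel" for c
    by (intro borel_measurable_continuous_onI continuous_intros)
  have "(\<integral>t. indicator {-(L/2)<..<L/2} t *\<^sub>R cis (2 * pi * (m / L * t)) \<partial>lborel)
      = (\<integral>t. indicator {-(L/2)..L/2} t *\<^sub>R cis (a * t) \<partial>lborel)"
  proof (rule integral_cong_AE)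
    show "AE t in lborel. indicator {- (L / 2)<..<L / 2} t *\<^sub>R cis (2 * pi * (m / L * t)) =
      indicator {- (L / 2)..L / 2} t *\<^sub>R cis (a * t)"
      using AE_lborel_singleton[of "L/2"] AE_lborel_singleton[of "-(L/2)"]
      by eventually_elim (auto simp: indicator_def a_def mult.assoc)
  qed (unfold mult.assoc[symmetric], measurable)
  also have "\<dots> = ?F (L/2) - ?F (-(L/2))"
  proof (rule integral_FTC_Icc)
    show "(?F has_vector_derivative cis (a * t)) (at t within {- (L / 2)..L / 2})" for t
    proof -
      have "((\<lambda>t. exp (\<i> * (of_real a * of_real t)) / (\<i> * a)) has_vector_derivative
              exp (\<i> * (of_real a * of_real t))) (at t within {- (L / 2)..L / 2})"
        by (rule has_vector_derivative_real_field)
           (use a in \<open>auto intro!: derivative_eq_intros simp: mult_ac\<close>)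
      then show ?thesis by (simp add: cis_conv_exp)
    qed
  qed (use L a in \<open>auto intro!: continuous_intros\<close>)
  also have "a * (L/2) = a * (-(L/2)) + 2 * pi * of_int m" using L by (simp add: a_def field_simps)
  also have "cis \<dots> = cis (a * (-(L/2)))"
    by (simp only: cis_mult[symmetric] cis_multiple_2pi[of "of_int m", OF Ints_of_int] mult_1_right)
  finally show ?thesis by simp
qed

text \<open>The integral is a product of integrals over the coordinates, and a coordinate with non-zero
frequency contributes an integral over whole periods.\<close>

lemma integral_character_cube:
  fixes k :: "int ^ 'n"
  assumes L: "L > 0"
  shows "(\<integral>x. indicator (cube L) x *\<^sub>R character (lattice_point L k) x \<partial>lborel) =
    (if k = 0 then of_real (L ^ CARD('n)) else 0)"
proof (cases "k = 0")
  case True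
  then have "lattice_point L k = 0" by (simp add: lattice_point_def vec_eq_iff)
  then show ?thesis using True L emeasure_cube[OF L, where 'n='n]
    by (simp add: measure_def scaleR_conv_of_real)
next
  case False
  then obtain i where i: "k $ i \<noteq> 0" by (auto simp: vec_eq_iff)
  let ?l = "lattice_point L k"
  let ?f = "\<lambda>b t. indicator {-(L/2)<..<L/2} t *\<^sub>R cis (2 * pi * ((?l \<bullet> b) * t))"
  have e: "indicator (cube L) x *\<^sub>R character ?l x = (\<Prod>b\<in>Basis. ?f b (x \<bullet> b))" for x
  proof -
    have 1: "character ?l x = (\<Prod>b\<in>Basis. cis (2 * pi * ((?l \<bullet> b) * (x \<bullet> b))))"
      unfolding character_def by (subst euclidean_inner[of ?l x])
        (simp add: cis_conv_exp exp_sum sum_distrib_left)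
    have 2: "(indicator (cube L) x :: real) = (\<Prod>b\<in>Basis. indicator {-(L/2)<..<L/2} (x \<bullet> b))"
    proof -
      have "x \<in> cube L \<longleftrightarrow> (\<forall>b\<in>Basis. x \<bullet> b \<in> {-(L/2)<..<L/2})"
        unfolding cube_eq_box mem_box by (auto simp: Basis_vec_def inner_axis)
      moreover have "(\<Prod>b\<in>Basis. indicator {-(L/2)<..<L/2} (x \<bullet> b)) =
          (if \<forall>b\<in>Basis. x \<bullet> b \<in> {-(L/2)<..<L/2} then 1 else 0 :: real)"
        by (auto intro!: prod.neutral prod_zero bexI simp: indicator_def simp del: greaterThanLessThan_iff)
      ultimately show ?thesis by (simp add: indicator_def)
    qed
    show ?thesis
      unfolding 1 2 by (simp add: scaleR_conv_of_real prod.distrib)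
  qed
  have int: "integrable lborel (?f b)" for b
  proof (rule Bochner_Integration.integrable_bound[of _ "indicator {-(L/2)<..<L/2} :: real \<Rightarrow> real"])
    have "(\<lambda>t. cis (2 * pi * ((?l \<bullet> b) * t))) \<in> borel_measurable borel"
      by (intro borel_measurable_continuous_onI continuous_intros)
    then show "?f b \<in> borel_measurable lborel" by measurable
  qed (use L in \<open>auto simp: indicator_def\<close>)
  have "(\<integral>t. ?f (axis i 1) t \<partial>lborel) = 0"
    using integral_cis_period[OF L i] by (simp add: lattice_point_def inner_axis)
  moreover have "axis i 1 \<in> (Basis :: (real ^ 'n) set)" by (auto simp: Basis_vec_def)
  ultimately have "(\<Prod>b\<in>(Basis :: (real ^ 'n) set). (\<integral>t. ?f b t \<partial>lborel)) = 0"
    by (intro prod_zero) auto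
  then show ?thesis
    unfolding e using False by (subst integral_lborel_prod[OF int]) auto
qed

section \<open>Square-integrable functions and Parseval for a dense orthogonal system\<close>

lemma L2D:
  assumes "f \<in> L2 M" shows "f \<in> borel_measurable M" "integrable M (\<lambda>x. (norm (f x))\<^sup>2)"
  using assms by (auto simp: L2_def)

lemma norm_add_sq_le: "(norm (a + b))\<^sup>2 \<le> 2 * (norm a)\<^sup>2 + 2 * (norm (b::'a::real_normed_vector))\<^sup>2"
proof -
  have "(norm (a + b))\<^sup>2 \<le> (norm a + norm b)\<^sup>2"
    by (intro power_mono norm_triangle_ineq) auto
  also have "\<dots> \<le> 2 * (norm a)\<^sup>2 + 2 * (norm b)\<^sup>2"
    using sum_squares_bound[of "norm a" "norm b"] by (simp add: power2_sum)
  finally show ?thesis .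
qed

lemma L2_add:
  assumes f: "f \<in> L2 M" and g: "g \<in> L2 M" shows "(\<lambda>x. f x + g x) \<in> L2 M"
proof -
  note [measurable] = L2D(1)[OF f] L2D(1)[OF g]
  have "integrable M (\<lambda>x. (norm (f x + g x))\<^sup>2)"
    by (rule Bochner_Integration.integrable_bound[where f="\<lambda>x. 2 * (norm (f x))\<^sup>2 + 2 * (norm (g x))\<^sup>2"])
       (use L2D(2)[OF f] L2D(2)[OF g] norm_add_sq_le in auto)
  then show ?thesis by (simp add: L2_def)
qed

lemma L2_mult_bounded:
  assumes f: "f \<in> L2 M" and [measurable]: "h \<in> borel_measurable M" and h: "\<And>x. norm (h x) \<le> c"
  shows "(\<lambda>x. h x * f x) \<in> L2 M"
proof -
  note [measurable] = L2D(1)[OF f]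
  have "integrable M (\<lambda>x. (norm (h x * f x))\<^sup>2)"
  proof (rule Bochner_Integration.integrable_bound[where f="\<lambda>x. c\<^sup>2 * (norm (f x))\<^sup>2"])
    show "AE x in M. norm ((norm (h x * f x))\<^sup>2) \<le> norm (c\<^sup>2 * (norm (f x))\<^sup>2)"
      using h by (auto simp: norm_mult power_mult_distrib intro!: mult_right_mono power_mono)
  qed (use L2D(2)[OF f] in auto)
  then show ?thesis by (simp add: L2_def)
qed

lemma L2_cmult: "f \<in> L2 M \<Longrightarrow> (\<lambda>x. c * f x) \<in> L2 M"
  by (rule L2_mult_bounded[where c="norm c"]) auto

lemma L2_diff:
  assumes f: "f \<in> L2 M" and g: "g \<in> L2 M" shows "(\<lambda>x. f x - g x) \<in> L2 M"
  using L2_add[OF f L2_cmult[OF g, of "-1"]] by simp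

lemma (in finite_measure) L2_bounded:
  assumes "f \<in> borel_measurable M" and "\<And>x. norm (f x) \<le> c" shows "f \<in> L2 M"
proof -
  have "(\<lambda>_. 1) \<in> L2 M" by (simp add: L2_def)
  from L2_mult_bounded[OF this assms] show ?thesis by simp
qed

lemma (in finite_measure) L2_integrable:
  assumes f: "f \<in> L2 M" shows "integrable M f"
proof (rule Bochner_Integration.integrable_bound[where f="\<lambda>x. 1 + (norm (f x))\<^sup>2"])
  show "AE x in M. norm (f x) \<le> norm (1 + (norm (f x))\<^sup>2)"
  proof (rule AE_I2)
    fix x
    have "norm (f x) \<le> 1 + (norm (f x))\<^sup>2"
      using sum_squares_bound[of "norm (f x)" 1] norm_ge_zero[of "f x"] by (simp del: norm_ge_zero)
    then show "norm (f x) \<le> norm (1 + (norm (f x))\<^sup>2)" by simp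
  qed
qed (use L2D[OF f] in auto)

text \<open>Completing the square in the coefficients \<open>c k\<close>. The choice \<open>c k = \<integral> g * cnj (e k) / V\<close> makes the
last sum vanish, which gives Bessel's inequality. For every other choice that sum is non-negative, so the error of any
approximation bounds the defect in Bessel's inequality from above.\<close>

lemma (in finite_measure) parseval_defect:
  fixes e :: "'k \<Rightarrow> 'a \<Rightarrow> complex"
  assumes [measurable]: "\<And>k. e k \<in> borel_measurable M"
    and e: "\<And>k x. norm (e k x) \<le> 1"
    and orth: "\<And>j k. (\<integral>x. e j x * cnj (e k x) \<partial>M) = (if j = k then of_real V else 0)"
    and V: "V > 0"
    and g: "g \<in> L2 M"
    and F: "finite F"
  shows "V * (\<integral>x. (norm (g x - (\<Sum>k\<in>F. c k * e k x)))\<^sup>2 \<partial>M) =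
    V * (\<integral>x. (norm (g x))\<^sup>2 \<partial>M) - (\<Sum>k\<in>F. (norm (\<integral>x. g x * cnj (e k x) \<partial>M))\<^sup>2)
      + (\<Sum>k\<in>F. (norm (V * c k - (\<integral>x. g x * cnj (e k x) \<partial>M)))\<^sup>2)"
proof -
  note [measurable] = L2D(1)[OF g]
  define a where "a k = (\<integral>x. g x * cnj (e k x) \<partial>M)" for k
  have gi: "integrable M g" by (rule L2_integrable[OF g])
  have i1: "integrable M (\<lambda>x. g x * cnj (e k x))" for k
    by (rule Bochner_Integration.integrable_bound[OF gi])
       (use e in \<open>auto simp: norm_mult intro!: mult_left_le\<close>)
  have i2: "integrable M (\<lambda>x. cnj (g x) * e k x)" for k
    using i1[of k] by (subst (asm) complex_integrable_cnj[symmetric]) simp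
  have i3: "integrable M (\<lambda>x. e j x * cnj (e k x))" for j k
    by (rule integrable_const_bound[where B=1])
       (use e in \<open>auto simp: norm_mult intro!: mult_le_one\<close>)
  have a': "(\<integral>x. cnj (g x) * e k x \<partial>M) = cnj (a k)" for k
    unfolding a_def Bochner_Integration.integral_cnj[symmetric] by simp
  have i0: "integrable M (\<lambda>x. g x * cnj (g x))"
    using L2D(2)[OF g] by (simp add: complex_norm_square[symmetric] del: of_real_power)
  have "complex_of_real (\<integral>x. (norm (g x - (\<Sum>k\<in>F. c k * e k x)))\<^sup>2 \<partial>M) =
     (\<integral>x. g x * cnj (g x) - (\<Sum>k\<in>F. cnj (c k) * (g x * cnj (e k x)))
        - (\<Sum>k\<in>F. c k * (cnj (g x) * e k x))
        + (\<Sum>j\<in>F. \<Sum>k\<in>F. c j * cnj (c k) * (e j x * cnj (e k x))) \<partial>M)"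
    unfolding integral_complex_of_real[symmetric] complex_norm_square
    by (intro Bochner_Integration.integral_cong refl)
       (simp add: algebra_simps sum_distrib_left sum_distrib_right sum_product, subst sum.swap, rule refl)
  also have "\<dots> = (\<integral>x. g x * cnj (g x) \<partial>M) - (\<Sum>k\<in>F. cnj (c k) * a k) - (\<Sum>k\<in>F. c k * cnj (a k))
        + (\<Sum>j\<in>F. \<Sum>k\<in>F. c j * cnj (c k) * (if j = k then of_real V else 0))"
    by (simp add: i0 i1 i2 i3 a' a_def[symmetric] orth)
  also have "\<dots> = of_real (\<integral>x. (norm (g x))\<^sup>2 \<partial>M) +
     (\<Sum>k\<in>F. V * (c k * cnj (c k)) - cnj (c k) * a k - c k * cnj (a k))"
    using F unfolding integral_complex_of_real[symmetric] complex_norm_square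
    by (simp add: sum.distrib sum_subtractf if_distrib[where f="\<lambda>x. _ * x"] mult_ac cong: if_cong)
  also have "of_real V * \<dots> = of_real (V * (\<integral>x. (norm (g x))\<^sup>2 \<partial>M) - (\<Sum>k\<in>F. (norm (a k))\<^sup>2)
      + (\<Sum>k\<in>F. (norm (V * c k - a k))\<^sup>2))"
    by (simp add: complex_norm_square algebra_simps sum_distrib_left sum_distrib_right sum.distrib sum_subtractf
        del: of_real_power)
  finally show ?thesis
    unfolding a_def[symmetric] of_real_mult[symmetric] of_real_eq_iff .
qed

lemma (in finite_measure) parseval_of_dense_span:
  fixes e :: "'k \<Rightarrow> 'a \<Rightarrow> complex"
  assumes meas: "\<And>k. e k \<in> borel_measurable M"
    and e: "\<And>k x. norm (e k x) \<le> 1"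
    and orth: "\<And>j k. (\<integral>x. e j x * cnj (e k x) \<partial>M) = (if j = k then of_real V else 0)"
    and V: "V > 0"
    and g: "g \<in> L2 M"
    and dense: "\<And>\<epsilon>. \<epsilon> > 0 \<Longrightarrow> \<exists>F c. finite F \<and> (\<integral>x. (norm (g x - (\<Sum>k\<in>F. c k * e k x)))\<^sup>2 \<partial>M) < \<epsilon>"
  shows "((\<lambda>k. (norm (\<integral>x. g x * cnj (e k x) \<partial>M))\<^sup>2) has_sum (V * (\<integral>x. (norm (g x))\<^sup>2 \<partial>M))) UNIV"
proof -
  define a where "a k = (\<integral>x. g x * cnj (e k x) \<partial>M)" for k
  define S where "S = V * (\<integral>x. (norm (g x))\<^sup>2 \<partial>M)"
  note defect = parseval_defect[OF meas e orth V g, folded a_def S_def]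
  have le: "(\<Sum>k\<in>F. (norm (a k))\<^sup>2) \<le> S" if F: "finite F" for F
  proof -
    have "0 \<le> V * (\<integral>x. (norm (g x - (\<Sum>k\<in>F. (a k / V) * e k x)))\<^sup>2 \<partial>M)"
      using V by (intro mult_nonneg_nonneg) auto
    also have "\<dots> = S - (\<Sum>k\<in>F. (norm (a k))\<^sup>2)"
      using V by (subst defect[OF F]) auto
    finally show ?thesis by simp
  qed
  have ge: "S \<le> s" if s: "\<And>F. finite F \<Longrightarrow> (\<Sum>k\<in>F. (norm (a k))\<^sup>2) \<le> s" for s
  proof (rule field_le_epsilon)
    fix \<epsilon> :: real assume "\<epsilon> > 0"
    then have "\<epsilon> / V > 0" using V by simp
    from dense[OF this] obtain F c where F: "finite F"
      and lt: "(\<integral>x. (norm (g x - (\<Sum>k\<in>F. c k * e k x)))\<^sup>2 \<partial>M) < \<epsilon> / V" by blast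
    have "S - (\<Sum>k\<in>F. (norm (a k))\<^sup>2) \<le> V * (\<integral>x. (norm (g x - (\<Sum>k\<in>F. c k * e k x)))\<^sup>2 \<partial>M)"
      unfolding defect[OF F] by (simp add: sum_nonneg)
    also have "\<dots> \<le> \<epsilon>" using lt V by (simp add: field_simps)
    finally show "S \<le> s + \<epsilon>" using s[OF F] by simp
  qed
  have bdd: "bdd_above (sum (\<lambda>k. (norm (a k))\<^sup>2) ` {F. F \<subseteq> UNIV \<and> finite F})"
    using le by (auto intro!: bdd_aboveI[where M=S])
  have summ: "(\<lambda>k. (norm (a k))\<^sup>2) summable_on UNIV"
    by (rule nonneg_bdd_above_summable_on[OF _ bdd]) auto
  have "infsum (\<lambda>k. (norm (a k))\<^sup>2) UNIV = S"
  proof (rule antisym)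
    show "infsum (\<lambda>k. (norm (a k))\<^sup>2) UNIV \<le> S"
      by (rule infsum_le_finite_sums[OF summ]) (use le in auto)
    show "S \<le> infsum (\<lambda>k. (norm (a k))\<^sup>2) UNIV"
      by (rule ge) (auto intro!: finite_sum_le_infsum[OF summ])
  qed
  with summ show ?thesis unfolding a_def S_def by (simp add: has_sum_iff)
qed

section \<open>Trigonometric polynomials and the torus\<close>

abbreviation cube_measure :: "real \<Rightarrow> (real ^ 'n) measure" where
  "cube_measure L \<equiv> density lborel (indicator (cube L))"

lemma finite_measure_cube:
  assumes "L > 0" shows "finite_measure (cube_measure L :: (real ^ 'n) measure)"
proof
  have "emeasure (cube_measure L :: (real ^ 'n) measure) UNIV = ennreal (L ^ CARD('n))"
    using emeasure_cube[OF assms, where 'n='n] by (subst emeasure_density) auto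
  then show "emeasure (cube_measure L :: (real ^ 'n) measure) (space (cube_measure L)) \<noteq> \<infinity>" by simp
qed

lemma integral_cube_measure:
  fixes f :: "real ^ 'n \<Rightarrow> 'b::{banach, second_countable_topology}"
  assumes [measurable]: "f \<in> borel_measurable borel"
  shows "(\<integral>x. f x \<partial>cube_measure L) = (\<integral>x. indicator (cube L) x *\<^sub>R f x \<partial>lborel)"
proof -
  have "(\<integral>x. f x \<partial>density lborel (\<lambda>x. ennreal (indicator (cube L) x))) = (\<integral>x. indicator (cube L) x *\<^sub>R f x \<partial>lborel)"
    by (rule integral_density) auto
  then show ?thesis by (simp add: ennreal_indicator)
qed

lemma lattice_point_0 [simp]: "lattice_point L 0 = 0"
  by (simp add: lattice_point_def vec_eq_iff)

definition trig_polynomial :: "real \<Rightarrow> (real ^ 'n \<Rightarrow> complex) \<Rightarrow> bool" where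
  "trig_polynomial L f \<longleftrightarrow>
    (\<exists>F c. finite F \<and> f = (\<lambda>x. \<Sum>k\<in>F. c k * character (lattice_point L k) x))"

lemma trig_polynomial_monomial: "trig_polynomial L (\<lambda>x. c * character (lattice_point L k) x)"
  unfolding trig_polynomial_def by (intro exI[of _ "{k}"] exI[of _ "\<lambda>_. c"]) simp

lemma trig_polynomial_const: "trig_polynomial L (\<lambda>x. c)"
  using trig_polynomial_monomial[of L c 0] by simp

lemma trig_polynomial_add:
  assumes "trig_polynomial L f" "trig_polynomial L g"
  shows "trig_polynomial L (\<lambda>x. f x + g x)"
proof -
  obtain F c G d where F: "finite F" "f = (\<lambda>x. \<Sum>k\<in>F. c k * character (lattice_point L k) x)"
    and G: "finite G" "g = (\<lambda>x. \<Sum>k\<in>G. d k * character (lattice_point L k) x)"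
    using assms unfolding trig_polynomial_def by blast
  let ?c = "\<lambda>k. (if k \<in> F then c k else 0) + (if k \<in> G then d k else 0)"
  have "f x + g x = (\<Sum>k\<in>F \<union> G. ?c k * character (lattice_point L k) x)" for x
  proof -
    have "f x = (\<Sum>k\<in>F \<union> G. (if k \<in> F then c k else 0) * character (lattice_point L k) x)"
      unfolding F(2) using F(1) G(1) by (intro sum.mono_neutral_cong_left) auto
    moreover have "g x = (\<Sum>k\<in>F \<union> G. (if k \<in> G then d k else 0) * character (lattice_point L k) x)"
      unfolding G(2) using F(1) G(1) by (intro sum.mono_neutral_cong_left) auto
    ultimately show ?thesis by (simp add: sum.distrib distrib_right)
  qed
  then show ?thesis
    unfolding trig_polynomial_def using F(1) G(1) by (intro exI[of _ "F \<union> G"] exI[of _ ?c]) auto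
qed

lemma trig_polynomial_sum:
  assumes "finite I" "\<And>i. i \<in> I \<Longrightarrow> trig_polynomial L (f i)"
  shows "trig_polynomial L (\<lambda>x. \<Sum>i\<in>I. f i x)"
  using assms by (induction rule: finite_induct) (auto intro: trig_polynomial_const trig_polynomial_add)

lemma trig_polynomial_mult:
  assumes "trig_polynomial L f" "trig_polynomial L g"
  shows "trig_polynomial L (\<lambda>x. f x * g x)"
proof -
  obtain F c G d where F: "finite F" "f = (\<lambda>x. \<Sum>k\<in>F. c k * character (lattice_point L k) x)"
    and G: "finite G" "g = (\<lambda>x. \<Sum>k\<in>G. d k * character (lattice_point L k) x)"
    using assms unfolding trig_polynomial_def by blast
  have "trig_polynomial L (\<lambda>x. \<Sum>j\<in>F. \<Sum>k\<in>G. (c j * d k) * character (lattice_point L (j + k)) x)"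
    using F(1) G(1) by (intro trig_polynomial_sum trig_polynomial_monomial)
  then show ?thesis
    by (simp add: F(2) G(2) sum_product lattice_point_add character_add mult_ac)
qed

text \<open>This wraps the cube of side \<open>L\<close> around a torus by gluing opposite faces.\<close>

definition torus_map :: "real \<Rightarrow> real ^ 'n \<Rightarrow> complex ^ 'n" where
  "torus_map L x = (\<chi> i. cis (2 * pi * (x $ i / L)))"

lemma continuous_torus_map: "continuous_on S (torus_map L)"
  unfolding torus_map_def[abs_def] divide_inverse by (intro continuous_intros)

text \<open>Only boundary points are glued together, so the preimage of the image of an interior point is that
point alone.\<close>

lemma torus_map_eq_imp_eq:
  assumes "x \<in> cube L" "y \<in> closure (cube L)" "torus_map L x = torus_map L y"
  shows "x = y"
proof -
  have "closure (cube L :: (real ^ 'n) set) \<subseteq> cbox (\<chi> i. - (L / 2)) (\<chi> i. L / 2)"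
    unfolding cube_eq_box by (intro closure_minimal box_subset_cbox closed_cbox)
  then have y: "- (L / 2) \<le> y $ i" "y $ i \<le> L / 2" for i using assms(2) by (auto simp: mem_box_cart)
  have x: "\<bar>x $ i\<bar> < L / 2" for i using assms(1) by (auto simp: cube_def)
  have "x $ i = y $ i" for i
  proof -
    have L: "L > 0" using x[of i] by simp
    have "cis (2 * pi * (x $ i / L)) = cis (2 * pi * (y $ i / L))"
      using assms(3) by (auto simp: torus_map_def vec_eq_iff)
    then have "cis (2 * pi * (x $ i / L) - 2 * pi * (y $ i / L)) = 1"
      by (simp flip: cis_divide)
    then have "cos (2 * pi * (x $ i / L) - 2 * pi * (y $ i / L)) = 1"
      by (metis cis.sel(1) one_complex.sel(1))
    then obtain m :: int where "2 * pi * (x $ i / L) - 2 * pi * (y $ i / L) = m * 2 * pi"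
      by (auto simp: cos_one_2pi_int)
    then have "2 * pi * (x $ i / L - y $ i / L) = 2 * pi * m" by (simp add: algebra_simps)
    then have "x $ i / L - y $ i / L = m" by simp
    then have m: "x $ i - y $ i = m * L" using L by (simp add: field_simps)
    have "\<bar>x $ i - y $ i\<bar> < L" using x[of i] y[of i] by linarith
    then have "\<bar>of_int m\<bar> * L < 1 * L" unfolding m using L by (simp add: abs_mult)
    then have "\<bar>real_of_int m\<bar> < 1" using L by (simp only: mult_less_cancel_right)
    then have "m = 0" by linarith
    with m show ?thesis by simp
  qed
  then show ?thesis by (simp add: vec_eq_iff)
qed

text \<open>The real coordinates of the torus are cosines and sines, that is, combinations of two opposite
characters, and products of characters are characters.\<close>

lemma trig_polynomial_torus_map:
  assumes "real_polynomial_function p"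
  shows "trig_polynomial L (\<lambda>x. complex_of_real (p (torus_map L x)))"
  using assms
proof induction
  case (linear f)
  interpret f: bounded_linear f by fact
  let ?e = "\<lambda>i::'b. (axis i 1 :: int ^ 'b)"
  \<comment> \<open>A real-linear functional is determined by its values on the real and the imaginary axis of every
  coordinate.\<close>
  have lin: "f z = (\<Sum>i\<in>UNIV. Re (z $ i) * f (axis i 1) + Im (z $ i) * f (axis i \<i>))" for z
  proof -
    have "z = (\<Sum>i\<in>UNIV. Re (z $ i) *\<^sub>R axis i 1 + Im (z $ i) *\<^sub>R axis i \<i>)"
      by (simp add: vec_eq_iff axis_def if_distrib[where f="\<lambda>x. _ *\<^sub>R x"] sum.distrib complex_eq_iff cong: if_cong)
    then have "f z = f (\<Sum>i\<in>UNIV. Re (z $ i) *\<^sub>R axis i 1 + Im (z $ i) *\<^sub>R axis i \<i>)" by simp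
    then show ?thesis by (simp add: f.sum f.add f.scaleR)
  qed
  have coord: "cis (2 * pi * (x $ i / L)) = character (lattice_point L (?e i)) x"
      "cnj (cis (2 * pi * (x $ i / L))) = character (lattice_point L (- ?e i)) x" for i x
  proof -
    have 1: "lattice_point L (?e i) = axis i (1 / L)" "lattice_point L (- ?e i) = - axis i (1 / L)"
      by (auto simp: lattice_point_def vec_eq_iff axis_def)
    show "cis (2 * pi * (x $ i / L)) = character (lattice_point L (?e i)) x"
      "cnj (cis (2 * pi * (x $ i / L))) = character (lattice_point L (- ?e i)) x"
      unfolding 1 character_minus by (simp_all add: character_def inner_axis inner_commute)
  qed
  have Re: "of_real (cos (2 * pi * (x $ i / L))) = 1/2 * character (lattice_point L (?e i)) x + 1/2 * character (lattice_point L (- ?e i)) x"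
    and Im: "of_real (sin (2 * pi * (x $ i / L))) = - (\<i>/2) * character (lattice_point L (?e i)) x + \<i>/2 * character (lattice_point L (- ?e i)) x" for i x
    unfolding coord[symmetric] by (auto simp: complex_eq_iff)
  show ?case
    by (subst lin,
        simp only: torus_map_def of_real_sum of_real_add of_real_mult vec_lambda_beta cis.sel Re Im,
        intro trig_polynomial_sum trig_polynomial_add trig_polynomial_mult trig_polynomial_const trig_polynomial_monomial finite)
next
  case (const c)
  then show ?case by (rule trig_polynomial_const)
next
  case (add f g)
  then show ?case using trig_polynomial_add[OF add.IH] by simp
next
  case (mult f g)
  then show ?case using trig_polynomial_mult[OF mult.IH] by simp
qed

definition trig_approximable :: "real \<Rightarrow> (real ^ 'n \<Rightarrow> complex) \<Rightarrow> bool" where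
  "trig_approximable L g \<longleftrightarrow>
    (\<forall>\<epsilon>>0. \<exists>T. trig_polynomial L T \<and> (\<integral>x. (norm (g x - T x))\<^sup>2 \<partial>cube_measure L) < \<epsilon>)"

lemma trig_polynomial_measurable: "trig_polynomial L T \<Longrightarrow> T \<in> borel_measurable borel"
  unfolding trig_polynomial_def by auto

lemma trig_polynomial_L2:
  assumes "L > 0" "trig_polynomial L T" shows "T \<in> L2 (cube_measure L)"
proof -
  interpret finite_measure "cube_measure L :: (real ^ 'a) measure" by (rule finite_measure_cube[OF assms(1)])
  obtain F c where F: "finite F" "T = (\<lambda>x. \<Sum>k\<in>F. c k * character (lattice_point L k) x)"
    using assms(2) unfolding trig_polynomial_def by blast
  show ?thesis
  proof (rule L2_bounded[where c="\<Sum>k\<in>F. norm (c k)"])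
    show "norm (T x) \<le> (\<Sum>k\<in>F. norm (c k))" for x
      unfolding F(2) by (rule order.trans[OF norm_sum]) (simp add: norm_mult)
  qed (use trig_polynomial_measurable[OF assms(2)] in auto)
qed

lemma trig_approximable_limit:
  assumes L: "L > 0" and g: "g \<in> L2 (cube_measure L)"
    and approx: "\<And>\<epsilon>. \<epsilon> > 0 \<Longrightarrow> \<exists>h. h \<in> L2 (cube_measure L) \<and> trig_approximable L h \<and>
          (\<integral>x. (norm (g x - h x))\<^sup>2 \<partial>cube_measure L) < \<epsilon>"
  shows "trig_approximable L g"
  unfolding trig_approximable_def
proof (intro allI impI)
  fix \<epsilon> :: real assume "\<epsilon> > 0"
  then have e: "\<epsilon> / 4 > 0" by simp
  obtain h where h: "h \<in> L2 (cube_measure L)" "trig_approximable L h"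
    "(\<integral>x. (norm (g x - h x))\<^sup>2 \<partial>cube_measure L) < \<epsilon> / 4" using approx[OF e] by blast
  obtain T where T: "trig_polynomial L T" "(\<integral>x. (norm (h x - T x))\<^sup>2 \<partial>cube_measure L) < \<epsilon> / 4"
    using h(2) e unfolding trig_approximable_def by blast
  note T2 = trig_polynomial_L2[OF L T(1)]
  note [simp] = L2D(2)[OF L2_diff[OF g h(1)]] L2D(2)[OF L2_diff[OF h(1) T2]] L2D(2)[OF L2_diff[OF g T2]]
  have "(\<integral>x. (norm (g x - T x))\<^sup>2 \<partial>cube_measure L) \<le>
    (\<integral>x. 2 * (norm (g x - h x))\<^sup>2 + 2 * (norm (h x - T x))\<^sup>2 \<partial>cube_measure L)"
  proof (rule integral_mono)
    fix x show "(norm (g x - T x))\<^sup>2 \<le> 2 * (norm (g x - h x))\<^sup>2 + 2 * (norm (h x - T x))\<^sup>2"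
      using norm_add_sq_le[of "g x - h x" "h x - T x"] by simp
  qed auto
  also have "\<dots> < \<epsilon>" using h(3) T(2) by simp
  finally show "\<exists>T. trig_polynomial L T \<and> (\<integral>x. (norm (g x - T x))\<^sup>2 \<partial>cube_measure L) < \<epsilon>"
    using T(1) by blast
qed

lemma trig_approximable_add:
  assumes L: "L > 0" and g: "g \<in> L2 (cube_measure L)" "trig_approximable L g"
    and h: "h \<in> L2 (cube_measure L)" "trig_approximable L h"
  shows "trig_approximable L (\<lambda>x. g x + h x)"
  unfolding trig_approximable_def
proof (intro allI impI)
  fix \<epsilon> :: real assume "\<epsilon> > 0"
  then have e: "\<epsilon> / 4 > 0" by simp
  obtain S T where S: "trig_polynomial L S" "(\<integral>x. (norm (g x - S x))\<^sup>2 \<partial>cube_measure L) < \<epsilon> / 4"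
    and T: "trig_polynomial L T" "(\<integral>x. (norm (h x - T x))\<^sup>2 \<partial>cube_measure L) < \<epsilon> / 4"
    using g(2) h(2) e unfolding trig_approximable_def by blast
  have ST: "trig_polynomial L (\<lambda>x. S x + T x)" by (rule trig_polynomial_add[OF S(1) T(1)])
  note [simp] = L2D(2)[OF L2_diff[OF g(1) trig_polynomial_L2[OF L S(1)]]]
    L2D(2)[OF L2_diff[OF h(1) trig_polynomial_L2[OF L T(1)]]]
    L2D(2)[OF L2_diff[OF L2_add[OF g(1) h(1)] trig_polynomial_L2[OF L ST]]]
  have "(\<integral>x. (norm (g x + h x - (S x + T x)))\<^sup>2 \<partial>cube_measure L) \<le>
    (\<integral>x. 2 * (norm (g x - S x))\<^sup>2 + 2 * (norm (h x - T x))\<^sup>2 \<partial>cube_measure L)"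
  proof (rule integral_mono)
    fix x show "(norm (g x + h x - (S x + T x)))\<^sup>2 \<le> 2 * (norm (g x - S x))\<^sup>2 + 2 * (norm (h x - T x))\<^sup>2"
      using norm_add_sq_le[of "g x - S x" "h x - T x"] by (simp add: algebra_simps)
  qed auto
  also have "\<dots> < \<epsilon>" using S(2) T(2) by simp
  finally show "\<exists>T. trig_polynomial L T \<and> (\<integral>x. (norm (g x + h x - T x))\<^sup>2 \<partial>cube_measure L) < \<epsilon>"
    using ST by blast
qed

lemma trig_approximable_cmult:
  assumes "trig_approximable L g" shows "trig_approximable L (\<lambda>x. c * g x)"
  unfolding trig_approximable_def
proof (intro allI impI)
  fix \<epsilon> :: real assume e: "\<epsilon> > 0"
  have p: "1 + (norm c)\<^sup>2 > 0" by (simp add: add_pos_nonneg)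
  then have "\<epsilon> / (1 + (norm c)\<^sup>2) > 0" using e by simp
  then obtain T where T: "trig_polynomial L T"
      "(\<integral>x. (norm (g x - T x))\<^sup>2 \<partial>cube_measure L) < \<epsilon> / (1 + (norm c)\<^sup>2)"
    using assms unfolding trig_approximable_def by blast
  have "(\<integral>x. (norm (c * g x - c * T x))\<^sup>2 \<partial>cube_measure L) = (norm c)\<^sup>2 * (\<integral>x. (norm (g x - T x))\<^sup>2 \<partial>cube_measure L)"
    by (simp add: norm_mult power_mult_distrib flip: right_diff_distrib)
  also have "\<dots> \<le> (1 + (norm c)\<^sup>2) * (\<integral>x. (norm (g x - T x))\<^sup>2 \<partial>cube_measure L)"
    by (intro mult_right_mono) auto
  also have "\<dots> < \<epsilon>" using T(2) p by (simp add: field_simps)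
  finally show "\<exists>T. trig_polynomial L T \<and> (\<integral>x. (norm (c * g x - T x))\<^sup>2 \<partial>cube_measure L) < \<epsilon>"
    using trig_polynomial_mult[OF trig_polynomial_const[of L c] T(1)] by blast
qed

lemma trig_approximable_sum:
  assumes L: "L > 0" and "finite I"
    and "\<And>i. i \<in> I \<Longrightarrow> g i \<in> L2 (cube_measure L)" "\<And>i. i \<in> I \<Longrightarrow> trig_approximable L (g i)"
  shows "(\<lambda>x. \<Sum>i\<in>I. g i x) \<in> L2 (cube_measure L) \<and> trig_approximable L (\<lambda>x. \<Sum>i\<in>I. g i x)"
  using assms(2-)
proof (induction rule: finite_induct)
  case empty
  have "trig_approximable L (\<lambda>x. 0)"
    unfolding trig_approximable_def using trig_polynomial_const[of L 0] by force
  then show ?case using trig_polynomial_L2[OF L trig_polynomial_const[of L 0]] by simp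
next
  case (insert i I)
  then show ?case using L by (auto intro!: L2_add trig_approximable_add)
qed

section \<open>Density of trigonometric polynomials and Parseval on a cube\<close>

text \<open>Between a compact \<open>C \<subseteq> A\<close> and an open \<open>U \<supseteq> A\<close> of nearly the same measure there is room for a
continuous function. It is constructed on the torus, where \<open>C\<close> and the closed cube without \<open>U\<close> have disjoint
compact images, and is approximated uniformly by a polynomial there.\<close>

lemma trig_approximable_indicator:
  assumes L: "L > 0" and A: "A \<in> sets borel" "A \<subseteq> cube L"
  shows "trig_approximable L (indicator A :: real ^ 'n \<Rightarrow> complex)"
  unfolding trig_approximable_def
proof (intro allI impI)
  fix \<epsilon> :: real assume "\<epsilon> > 0"
  let ?M = "cube_measure L :: (real ^ 'n) measure"
  interpret finite_measure ?M by (rule finite_measure_cube[OF L])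
  let ?m = "measure ?M"
  define \<delta> where "\<delta> = \<epsilon> / 8"
  have \<delta>: "\<delta> > 0" using \<open>\<epsilon> > 0\<close> by (simp add: \<delta>_def)
  have sM: "sets ?M = sets borel" "emeasure ?M (space ?M) \<noteq> \<infinity>" "A \<in> sets borel" using A(1) by auto
  have em: "emeasure ?M X = ennreal (?m X)" for X by (rule emeasure_eq_measure)
  obtain C where C: "C \<subseteq> A" "compact C" "?m A < ?m C + \<delta>"
  proof -
    have "\<exists>C\<in>{K. K \<subseteq> A \<and> compact K}. ?m A < ?m C + \<delta>"
    proof (rule ccontr)
      assume "\<not> ?thesis"
      then have "\<And>C. C \<in> {K. K \<subseteq> A \<and> compact K} \<Longrightarrow> emeasure ?M C \<le> ennreal (?m A - \<delta>)"
        unfolding em by (intro ennreal_leI) force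
      then have "ennreal (?m A) \<le> ennreal (?m A - \<delta>)"
        unfolding em[symmetric] by (subst inner_regular[OF sM]) (rule SUP_least)
      moreover have "?m A > 0"
      proof (rule ccontr)
        assume "\<not> ?m A > 0"
        with \<open>\<not> (\<exists>C\<in>_. _)\<close> \<delta> show False by (auto simp: not_less dest!: bspec[of _ _ "{}"])
      qed
      ultimately show False using \<delta> by (cases "?m A - \<delta> \<ge> 0") (auto simp: ennreal_neg)
    qed
    then show ?thesis using that by blast
  qed
  obtain U where U: "A \<subseteq> U" "open U" "?m U < ?m A + \<delta>"
  proof -
    have "\<exists>U\<in>{U. A \<subseteq> U \<and> open U}. ?m U < ?m A + \<delta>"
    proof (rule ccontr)
      assume "\<not> ?thesis"
      then have "\<And>U. U \<in> {U. A \<subseteq> U \<and> open U} \<Longrightarrow> ennreal (?m A + \<delta>) \<le> emeasure ?M U"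
        unfolding em by (intro ennreal_leI) force
      then have "ennreal (?m A + \<delta>) \<le> ennreal (?m A)"
        unfolding em[symmetric] by (subst outer_regular[OF sM]) (rule INF_greatest)
      then show False using \<delta> by simp
    qed
    then show ?thesis using that by blast
  qed
  define D where "D = closure (cube L) - U"
  have bdd: "bounded (cube L :: (real ^ 'n) set)" unfolding cube_eq_box by (rule bounded_box)
  have D: "compact D"
    unfolding D_def using bdd U(2) by (intro compact_diff) (auto simp: compact_closure)
  have CL: "compact (closure (cube L :: (real ^ 'n) set))" using bdd by (simp add: compact_closure)
  have disj: "torus_map L ` C \<inter> torus_map L ` D = {}"
  proof -
    have "False" if "x \<in> C" "y \<in> D" "torus_map L x = torus_map L y" for x y
      using torus_map_eq_imp_eq[of x L y] that C(1) U(1) A(2) by (auto simp: D_def)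
    then show ?thesis by blast
  qed
  obtain H :: "complex ^ 'n \<Rightarrow> real" where H: "continuous_on UNIV H"
    "\<And>z. H z \<in> closed_segment 1 0" "\<And>z. z \<in> torus_map L ` C \<Longrightarrow> H z = 1" "\<And>z. z \<in> torus_map L ` D \<Longrightarrow> H z = 0"
  proof (rule Urysohn[of "torus_map L ` C" "torus_map L ` D" 1 "0::real"])
    show "closed (torus_map L ` C)" "closed (torus_map L ` D)"
      using C(2) D by (auto intro!: compact_imp_closed compact_continuous_image continuous_torus_map)
  qed (use disj in auto)
  have H01: "0 \<le> H z" "H z \<le> 1" for z using H(2)[of z] by (auto simp: closed_segment_eq_real_ivl)
  define m where "m = ?m UNIV"
  have m: "m \<ge> 0" by (simp add: m_def)
  \<comment> \<open>Adding \<open>1\<close> to the total mass avoids a division by zero; the uniform error \<open>\<eta>\<close> then costs at most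
  \<open>\<delta>\<close> in the square integral.\<close>
  define \<eta> where "\<eta> = sqrt (\<delta> / (m + 1))"
  have \<eta>: "\<eta> > 0" "\<eta>\<^sup>2 * m \<le> \<delta>" using \<delta> m by (auto simp: \<eta>_def field_simps)
  obtain p where p: "real_polynomial_function p"
    "\<And>z. z \<in> torus_map L ` closure (cube L) \<Longrightarrow> \<bar>H z - p z\<bar> < \<eta>"
    using Stone_Weierstrass_real_polynomial_function[OF compact_continuous_image[OF continuous_torus_map CL] continuous_on_subset[OF H(1) subset_UNIV] \<eta>(1)]
    by blast
  let ?T = "\<lambda>x. complex_of_real (p (torus_map L x))"
  have T: "trig_polynomial L ?T" by (rule trig_polynomial_torus_map[OF p(1)])
  have UC: "U - C \<in> sets borel" using U(2) C(2) by (intro sets.Diff borel_open borel_closed compact_imp_closed)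
  have AL2: "indicator A \<in> L2 ?M"
    by (rule L2_bounded[where c=1]) (use A(1) in \<open>simp_all add: indicator_def\<close>)
  have bound: "(norm (indicator A x - ?T x))\<^sup>2 \<le> 2 * indicator (U - C) x + 2 * \<eta>\<^sup>2" if x: "x \<in> cube L" for x
  proof -
    let ?h = "H (torus_map L x)"
    have xc: "x \<in> closure (cube L)" using x closure_subset by blast
    have 1: "(indicator A x - ?h)\<^sup>2 \<le> (indicator (U - C) x :: real)"
    proof (cases "x \<in> C")
      case True
      then have "?h = 1" "x \<in> A" using H(3) C(1) by auto
      then show ?thesis by simp
    next
      case False
      show ?thesis
      proof (cases "x \<in> U")
        case True
        have "\<bar>indicator A x - ?h\<bar> \<le> 1" using H01[of "torus_map L x"] by (auto simp: indicator_def)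
        then have "(indicator A x - ?h)\<^sup>2 \<le> 1" by (simp add: abs_square_le_1)
        then show ?thesis using True False by simp
      next
        case False
        then have "x \<in> D" "x \<notin> A" using xc U(1) by (auto simp: D_def)
        then show ?thesis using H(4) by simp
      qed
    qed
    have 2: "(?h - p (torus_map L x))\<^sup>2 \<le> \<eta>\<^sup>2"
      using p(2)[of "torus_map L x"] xc \<eta>(1) by (intro power2_le_iff_abs_le[THEN iffD2]) auto
    have "indicator A x - ?T x = complex_of_real ((indicator A x - ?h) + (?h - p (torus_map L x)))"
      by (simp add: indicator_def)
    then have "norm (indicator A x - ?T x) = norm ((indicator A x - ?h) + (?h - p (torus_map L x)))"
      by (simp only: norm_of_real real_norm_def)
    then have "(norm (indicator A x - ?T x))\<^sup>2 \<le> 2 * (indicator A x - ?h)\<^sup>2 + 2 * (?h - p (torus_map L x))\<^sup>2"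
      using norm_add_sq_le[of "indicator A x - ?h" "?h - p (torus_map L x)"] by simp
    with 1 2 show ?thesis by simp
  qed
  have "(\<integral>x. (norm (indicator A x - ?T x))\<^sup>2 \<partial>?M) \<le> (\<integral>x. 2 * indicator (U - C) x + 2 * \<eta>\<^sup>2 \<partial>?M)"
  proof (rule integral_mono_AE)
    show "AE x in ?M. (norm (indicator A x - ?T x))\<^sup>2 \<le> 2 * indicator (U - C) x + 2 * \<eta>\<^sup>2"
      using bound by (subst AE_density) (auto simp: indicator_def)
    show "integrable ?M (\<lambda>x. (norm (indicator A x - ?T x))\<^sup>2)"
      by (intro L2D(2)[OF L2_diff[OF AL2 trig_polynomial_L2[OF L T]]])
  qed (use UC in \<open>auto simp: less_top[symmetric]\<close>)
  also have "\<dots> = 2 * ?m (U - C) + 2 * (\<eta>\<^sup>2 * m)"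
    using UC by (subst Bochner_Integration.integral_add) (auto simp: m_def less_top[symmetric])
  finally have "(\<integral>x. (norm (indicator A x - ?T x))\<^sup>2 \<partial>?M) \<le> 2 * ?m (U - C) + 2 * (\<eta>\<^sup>2 * m)" .
  moreover have "?m (U - C) = ?m U - ?m C"
    using C U by (intro finite_measure_Diff) (auto intro: borel_closed compact_imp_closed)
  moreover have "?m U - ?m C < 2 * \<delta>" using C(3) U(3) by linarith
  moreover have "8 * \<delta> = \<epsilon>" by (simp add: \<delta>_def)
  ultimately have "(\<integral>x. (norm (indicator A x - ?T x))\<^sup>2 \<partial>?M) < \<epsilon>"
    using \<eta>(2) \<delta> by linarith
  with T show "\<exists>T. trig_polynomial L T \<and> (\<integral>x. (norm (indicator A x - T x))\<^sup>2 \<partial>?M) < \<epsilon>"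
    by (intro exI[of _ ?T] conjI)
qed

lemma trig_approximable_cong_cube:
  assumes "\<And>x. x \<in> cube L \<Longrightarrow> f x = g x" "f \<in> borel_measurable borel" "g \<in> borel_measurable borel"
  shows "trig_approximable L f \<longleftrightarrow> trig_approximable L g"
proof -
  have "(\<integral>x. (norm (f x - T x))\<^sup>2 \<partial>cube_measure L) = (\<integral>x. (norm (g x - T x))\<^sup>2 \<partial>cube_measure L)"
    if "trig_polynomial L T" for T
  proof (rule integral_cong_AE)
    show "AE x in cube_measure L. (norm (f x - T x))\<^sup>2 = (norm (g x - T x))\<^sup>2"
      using assms(1) by (subst AE_density) (auto simp: indicator_def)
  qed (use assms(2,3) trig_polynomial_measurable[OF that] in simp_all)
  then show ?thesis unfolding trig_approximable_def by (simp cong: conj_cong)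
qed

text \<open>Simple functions are combinations of indicators, and they are dense in \<open>L\<^sup>2\<close> by dominated convergence.\<close>

lemma trig_approximable_L2:
  assumes L: "L > 0" and g: "g \<in> L2 (cube_measure L :: (real ^ 'n) measure)"
  shows "trig_approximable L g"
proof (rule trig_approximable_limit[OF L g])
  fix \<epsilon> :: real assume \<epsilon>: "\<epsilon> > 0"
  let ?M = "cube_measure L :: (real ^ 'n) measure"
  interpret finite_measure ?M by (rule finite_measure_cube[OF L])
  have gm [measurable]: "g \<in> borel_measurable borel" using L2D(1)[OF g] by simp
  obtain s where s: "\<And>i. simple_function ?M (s i)" "\<And>x. (\<lambda>i. s i x) \<longlonglongrightarrow> g x"
      "\<And>i x. norm (s i x) \<le> 2 * norm (g x)"
    using borel_measurable_implies_sequence_metric[OF L2D(1)[OF g], of 0] by auto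
  have sm [measurable]: "s i \<in> borel_measurable ?M" for i
    using borel_measurable_simple_function[OF s(1)] by simp
  have sL2: "s i \<in> L2 ?M" for i
  proof -
    have "integrable ?M (\<lambda>x. (norm (s i x))\<^sup>2)"
    proof (rule Bochner_Integration.integrable_bound[where f="\<lambda>x. 4 * (norm (g x))\<^sup>2"])
      have "(norm (s i x))\<^sup>2 \<le> (2 * norm (g x))\<^sup>2" for x by (intro power_mono s) auto
      then show "AE x in ?M. norm ((norm (s i x))\<^sup>2) \<le> norm (4 * (norm (g x))\<^sup>2)"
        by (simp add: power_mult_distrib)
    qed (use L2D(2)[OF g] in auto)
    then show ?thesis using sm by (simp add: L2_def)
  qed
  have approx: "trig_approximable L (s i)" for i
  proof -
    have fin: "finite (range (s i))" using s(1)[of i] by (simp add: simple_function_def)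
    have [measurable]: "s i -` {y} \<in> sets borel" for y
      using simple_functionD(2)[OF s(1)[of i], of "{y}"] by simp
    let ?A = "\<lambda>y. s i -` {y} \<inter> cube L"
    have "trig_approximable L (\<lambda>x. \<Sum>y\<in>range (s i). y * indicator (?A y) x)"
      using L fin
      by (intro trig_approximable_sum[THEN conjunct2] trig_approximable_cmult trig_approximable_indicator L2_cmult L2_bounded[where c=1])
         (auto simp: indicator_def)
    moreover have "(\<Sum>y\<in>range (s i). y * indicator (?A y) x) = s i x" if "x \<in> cube L" for x
    proof -
      have "(\<Sum>y\<in>range (s i). y * indicator (?A y) x) = (\<Sum>y\<in>range (s i). if y = s i x then y else 0)"
        using that by (intro sum.cong) (auto simp: indicator_def)
      then show ?thesis using fin by simp
    qed
    ultimately show ?thesis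
      using sm[of i] by (subst (asm) trig_approximable_cong_cube[where g="s i"]) auto
  qed
  have "(\<lambda>i. \<integral>x. (norm (g x - s i x))\<^sup>2 \<partial>?M) \<longlonglongrightarrow> (\<integral>x. 0 \<partial>?M)"
  proof (rule integral_dominated_convergence[where w="\<lambda>x. 9 * (norm (g x))\<^sup>2"])
    show "AE x in ?M. (\<lambda>i. (norm (g x - s i x))\<^sup>2) \<longlonglongrightarrow> 0"
    proof (rule AE_I2)
      fix x
      have "(\<lambda>i. (norm (g x - s i x))\<^sup>2) \<longlonglongrightarrow> (norm (g x - g x))\<^sup>2" by (intro tendsto_intros s)
      then show "(\<lambda>i. (norm (g x - s i x))\<^sup>2) \<longlonglongrightarrow> 0" by simp
    qed
    show "AE x in ?M. norm ((norm (g x - s i x))\<^sup>2) \<le> 9 * (norm (g x))\<^sup>2" for i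
    proof (rule AE_I2)
      fix x
      have "norm (g x - s i x) \<le> 3 * norm (g x)"
        using norm_triangle_ineq4[of "g x" "s i x"] s(3)[of i x] by linarith
      then have "(norm (g x - s i x))\<^sup>2 \<le> (3 * norm (g x))\<^sup>2" by (intro power_mono) auto
      then show "norm ((norm (g x - s i x))\<^sup>2) \<le> 9 * (norm (g x))\<^sup>2" by (simp add: power_mult_distrib)
    qed
  qed (use L2D(2)[OF g] in auto)
  then have "\<forall>\<^sub>F i in sequentially. (\<integral>x. (norm (g x - s i x))\<^sup>2 \<partial>?M) < \<epsilon>"
    using \<epsilon> by (intro order_tendstoD) auto
  then obtain i where "(\<integral>x. (norm (g x - s i x))\<^sup>2 \<partial>?M) < \<epsilon>"
    by (auto simp: eventually_sequentially)
  then show "\<exists>h. h \<in> L2 ?M \<and> trig_approximable L h \<and> (\<integral>x. (norm (g x - h x))\<^sup>2 \<partial>?M) < \<epsilon>"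
    using sL2 approx by blast
qed

text \<open>The characters of the lattice dual to the cube are orthogonal on it, and their span is dense in \<open>L\<^sup>2\<close> of the cube.\<close>

lemma has_sum_fourier_lattice:
  fixes g :: "real ^ 'n \<Rightarrow> complex"
  assumes L: "L > 0" and [measurable]: "g \<in> borel_measurable borel"
    and int: "integrable lborel (\<lambda>x. (norm (g x))\<^sup>2)"
    and supp: "\<And>x. x \<notin> cube L \<Longrightarrow> g x = 0"
  shows "((\<lambda>k. (norm (fourier g (lattice_point L k)))\<^sup>2) has_sum
      (L ^ CARD('n) * (\<integral>x. (norm (g x))\<^sup>2 \<partial>lborel))) UNIV"
proof -
  let ?M = "cube_measure L :: (real ^ 'n) measure"
  interpret finite_measure ?M by (rule finite_measure_cube[OF L])
  have restrict: "(\<integral>x. h x \<partial>?M) = (\<integral>x. h x \<partial>lborel)"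
    if "h \<in> borel_measurable borel" "\<And>x. g x = 0 \<Longrightarrow> h x = 0" for h :: "_ \<Rightarrow> 'b::{banach, second_countable_topology}"
    unfolding integral_cube_measure[OF that(1)]
  proof (intro Bochner_Integration.integral_cong refl)
    fix x show "indicator (cube L) x *\<^sub>R h x = h x"
      using that(2)[of x] supp[of x] by (cases "x \<in> cube L") auto
  qed
  have gL2: "g \<in> L2 ?M"
  proof -
    have "integrable (density lborel (\<lambda>x. ennreal (indicator (cube L) x))) (\<lambda>x. (norm (g x))\<^sup>2)"
      by (subst integrable_density)
         (auto intro!: Bochner_Integration.integrable_bound[OF int] simp: indicator_def)
    then show ?thesis by (simp add: L2_def ennreal_indicator)
  qed
  have orth: "(\<integral>x. character (lattice_point L j) x * cnj (character (lattice_point L k) x) \<partial>?M) =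
      (if j = k then of_real (L ^ CARD('n)) else 0)" for j k
    unfolding character_minus[symmetric] character_add[symmetric]
    using integral_character_cube[OF L, of "j - k"]
    by (subst integral_cube_measure) (auto simp: lattice_point_diff)
  have "((\<lambda>k. (norm (\<integral>x. g x * cnj (character (lattice_point L k) x) \<partial>?M))\<^sup>2) has_sum
      (L ^ CARD('n) * (\<integral>x. (norm (g x))\<^sup>2 \<partial>?M))) UNIV"
  proof (rule parseval_of_dense_span[OF _ _ orth _ gL2])
    fix \<epsilon> :: real assume "\<epsilon> > 0"
    then show "\<exists>F c. finite F \<and> (\<integral>x. (norm (g x - (\<Sum>k\<in>F. c k * character (lattice_point L k) x)))\<^sup>2 \<partial>?M) < \<epsilon>"
      using trig_approximable_L2[OF L gL2] unfolding trig_approximable_def trig_polynomial_def by blast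
  qed (use L in auto)
  moreover have "(\<integral>x. (norm (g x))\<^sup>2 \<partial>?M) = (\<integral>x. (norm (g x))\<^sup>2 \<partial>lborel)" by (rule restrict) auto
  moreover have "(\<integral>x. g x * cnj (character (lattice_point L k) x) \<partial>?M) = fourier g (lattice_point L k)" for k
    unfolding fourier_def by (rule restrict) auto
  ultimately show ?thesis by simp
qed

section \<open>Comparing sums over translates of a countable set\<close>

lemma nn_integral_count_space_infsum:
  fixes f :: "'a \<Rightarrow> real"
  assumes "f summable_on A" "\<And>x. x \<in> A \<Longrightarrow> 0 \<le> f x"
  shows "(\<integral>\<^sup>+x. ennreal (f x) \<partial>count_space A) = ennreal (infsum f A)"
proof -
  have "(\<lambda>x. norm (f x)) summable_on A"
    using assms by (simp cong: summable_on_cong)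
  then have abs: "Infinite_Set_Sum.abs_summable_on f A" by (rule abs_summable_equivalent[THEN iffD1])
  show ?thesis
    using nn_integral_conv_infsetsum[OF abs] assms(2) infsetsum_infsum[OF abs] by simp
qed

lemma nn_integral_lborel_shift:
  fixes f :: "'a::euclidean_space \<Rightarrow> ennreal"
  assumes [measurable]: "f \<in> borel_measurable borel"
  shows "(\<integral>\<^sup>+x. f (c + x) \<partial>lborel) = (\<integral>\<^sup>+x. f x \<partial>lborel)"
  by (subst (2) lborel_distr_plus[of c, symmetric], subst nn_integral_distr) auto

lemma nn_integral_lborel_reflect:
  fixes f :: "'a::euclidean_space \<Rightarrow> ennreal"
  assumes [measurable]: "f \<in> borel_measurable borel"
  shows "(\<integral>\<^sup>+x. f (c - x) \<partial>lborel) = (\<integral>\<^sup>+x. f x \<partial>lborel)"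
  by (subst (2) lborel_affine[of "-1" c]) (auto simp: nn_integral_density nn_integral_distr)

text \<open>The comparison below needs an integrable weight \<open>w\<close> with \<open>w x * w y \<le> w (x - y)\<close> that tends to \<open>1\<close>
as its parameter tends to \<open>0\<close>. The \<open>l\<^sup>1\<close> norm in the exponent gives the inequality by the triangle inequality and
integrability by splitting into coordinates.\<close>

definition weight :: "real \<Rightarrow> real ^ 'n \<Rightarrow> real" where
  "weight a x = exp (- a * (\<Sum>i\<in>UNIV. \<bar>x $ i\<bar>))"

lemma weight_pos [simp]: "weight a x > 0"
  by (simp add: weight_def)

lemma weight_nonneg [simp]: "weight a x \<ge> 0"
  by (simp add: weight_def)

lemma weight_measurable [measurable]: "weight a \<in> borel_measurable borel"
  unfolding weight_def[abs_def] by (intro borel_measurable_continuous_onI continuous_intros)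

lemma weight_antimono: "a \<le> b \<Longrightarrow> weight b x \<le> weight a x"
  unfolding weight_def by (simp add: mult_right_mono sum_nonneg)

lemma weight_diff:
  assumes "a \<ge> 0" shows "weight a x * weight a y \<le> weight a (x - y)"
proof -
  have "(\<Sum>i\<in>UNIV. \<bar>(x - y) $ i\<bar>) \<le> (\<Sum>i\<in>UNIV. \<bar>x $ i\<bar>) + (\<Sum>i\<in>UNIV. \<bar>y $ i\<bar>)"
    unfolding sum.distrib[symmetric] by (intro sum_mono) auto
  from mult_left_mono[OF this assms] show ?thesis
    by (simp add: weight_def algebra_simps flip: exp_add)
qed

lemma nn_integral_exp_abs:
  assumes "a > 0"
  shows "(\<integral>\<^sup>+t. ennreal (exp (- a * \<bar>t\<bar>)) \<partial>lborel) < \<infinity>"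
proof -
  have "((\<lambda>t. exp (- a * t)) \<longlongrightarrow> 0) at_top"
    using assms by real_asymp
  then have lim: "((\<lambda>t. - (exp (- a * t) / a)) \<longlongrightarrow> 0) at_top"
    using tendsto_minus[OF tendsto_divide[OF _ tendsto_const[of a]]] assms by fastforce
  have half: "(\<integral>\<^sup>+t. ennreal (exp (- a * t)) * indicator {0..} t \<partial>lborel) = ennreal (0 - (- (exp (- a * 0) / a)))"
    by (rule nn_integral_FTC_atLeast[OF _ _ _ lim])
       (use assms in \<open>auto intro!: derivative_eq_intros\<close>)
  have "(\<integral>\<^sup>+t. ennreal (exp (- a * \<bar>t\<bar>)) \<partial>lborel) \<le>
    (\<integral>\<^sup>+t. ennreal (exp (- a * t)) * indicator {0..} t + ennreal (exp (- a * (0 - t))) * indicator {0..} (0 - t) \<partial>lborel)"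
    by (intro nn_integral_mono) (auto simp: indicator_def)
  also have "\<dots> = (\<integral>\<^sup>+t. ennreal (exp (- a * t)) * indicator {0..} t \<partial>lborel)
      + (\<integral>\<^sup>+t. ennreal (exp (- a * (0 - t))) * indicator {0..} (0 - t) \<partial>lborel)"
    by (intro nn_integral_add) auto
  also have "(\<integral>\<^sup>+t. ennreal (exp (- a * (0 - t))) * indicator {0..} (0 - t) \<partial>lborel)
      = (\<integral>\<^sup>+t. ennreal (exp (- a * t)) * indicator {0..} t \<partial>lborel)"
    by (rule nn_integral_lborel_reflect) auto
  finally show ?thesis unfolding half by (auto simp: ennreal_add_less_top less_top top_unique elim: le_less_trans)
qed

lemma nn_integral_weight:
  fixes a :: real
  assumes "a > 0"
  shows "(\<integral>\<^sup>+x. ennreal (weight a (x :: real ^ 'n)) \<partial>lborel) < \<infinity>"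
    and "(\<integral>\<^sup>+x. ennreal (weight a (x :: real ^ 'n)) \<partial>lborel) > 0"
proof -
  have "weight a x = (\<Prod>b\<in>Basis. exp (- a * \<bar>x \<bullet> b\<bar>))" for x :: "real ^ 'n"
  proof -
    have "(\<Sum>b\<in>Basis. \<bar>x \<bullet> b\<bar>) = (\<Sum>i\<in>UNIV. \<bar>x $ i\<bar>)"
      by (simp add: Basis_vec_def sum.UNION_disjoint axis_eq_axis inner_axis)
    then show ?thesis unfolding weight_def by (simp add: exp_sum[symmetric] flip: sum_distrib_left) (simp add: sum_negf flip: sum_distrib_left)
  qed
  then have "(\<integral>\<^sup>+x. ennreal (weight a (x :: real ^ 'n)) \<partial>lborel) =
      (\<integral>\<^sup>+x. (\<Prod>b\<in>(Basis :: (real ^ 'n) set). ennreal (exp (- a * \<bar>x \<bullet> b\<bar>))) \<partial>lborel)"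
    by (simp add: prod_ennreal)
  also have "\<dots> = (\<Prod>b\<in>(Basis :: (real ^ 'n) set). (\<integral>\<^sup>+t. ennreal (exp (- a * \<bar>t\<bar>)) \<partial>lborel))"
    by (rule nn_integral_lborel_prod) auto
  also have "\<dots> < \<infinity>"
    using nn_integral_exp_abs[OF assms] by (simp add: ennreal_prod_eq_top less_top power_less_top_ennreal)
  finally show "(\<integral>\<^sup>+x. ennreal (weight a (x :: real ^ 'n)) \<partial>lborel) < \<infinity>" .
  have "(\<integral>\<^sup>+x. ennreal (weight a (x :: real ^ 'n)) \<partial>lborel) \<noteq> 0"
  proof
    assume "(\<integral>\<^sup>+x. ennreal (weight a (x :: real ^ 'n)) \<partial>lborel) = 0"
    then have "AE x in (lborel :: (real ^ 'n) measure). False"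
      by (subst (asm) nn_integral_0_iff_AE) (auto elim!: eventually_mono simp: not_less[symmetric] ennreal_eq_0_iff)
    then have "emeasure (lborel :: (real ^ 'n) measure) (space lborel) = 0"
      unfolding ae_filter_eq_bot_iff[symmetric] trivial_limit_def .
    then show False by simp
  qed
  then show "(\<integral>\<^sup>+x. ennreal (weight a (x :: real ^ 'n)) \<partial>lborel) > 0" by (simp add: zero_less_iff_neq_zero)
qed

text \<open>Integrate the hypotheses against translates of the weight \<open>w\<close> and put \<open>W c\<close> for the sum of
\<open>w (l - c)\<close> over \<open>l \<in> \<Lambda>\<close>, a smoothed count of the points of \<open>\<Lambda>\<close> near \<open>c\<close>. Exchanging sum and integral,
the bound for \<open>P\<close> gives \<open>p \<integral>w \<le> \<integral>W P \<le> (sup W) \<integral>P\<close>, whereas the bound for \<open>Q\<close> and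
\<open>w (l - c) * w x \<le> w (l - x - c)\<close> give \<open>W c * \<integral>w Q \<le> q \<integral>w\<close> for every \<open>c\<close>, hence the same bound for
\<open>sup W\<close>. Multiplying the two inequalities eliminates \<open>sup W\<close>, and \<open>\<integral>w\<close> cancels because it is positive and
finite.\<close>

lemma translate_sum_comparison_weight:
  fixes \<Lambda> :: "(real ^ 'n) set" and P Q :: "real ^ 'n \<Rightarrow> ennreal"
  assumes \<Lambda>: "countable \<Lambda>"
    and [measurable]: "P \<in> borel_measurable borel" "Q \<in> borel_measurable borel"
    and P: "\<And>\<xi>. p \<le> (\<integral>\<^sup>+l. P (l - \<xi>) \<partial>count_space \<Lambda>)"
    and Q: "\<And>\<xi>. (\<integral>\<^sup>+l. Q (l - \<xi>) \<partial>count_space \<Lambda>) \<le> q"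
    and a: "a > 0"
  shows "p * (\<integral>\<^sup>+x. weight a x * Q x \<partial>lborel) \<le> q * (\<integral>\<^sup>+x. P x \<partial>lborel)"
proof -
  define w where "w = (\<integral>\<^sup>+x. ennreal (weight a (x :: real ^ 'n)) \<partial>lborel)"
  define W where "W c = (\<integral>\<^sup>+l. ennreal (weight a (l - c)) \<partial>count_space \<Lambda>)" for c
  define \<kappa> where "\<kappa> = (\<integral>\<^sup>+x. weight a x * Q x \<partial>lborel)"
  have w: "w < \<infinity>" "w > 0" using nn_integral_weight[OF a] by (auto simp: w_def)
  have J: "(\<integral>\<^sup>+\<xi>. weight a (\<xi> - c) * (\<integral>\<^sup>+l. R (l - \<xi>) \<partial>count_space \<Lambda>) \<partial>lborel)
      = (\<integral>\<^sup>+l. (\<integral>\<^sup>+x. weight a (l - x - c) * R x \<partial>lborel) \<partial>count_space \<Lambda>)"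
    if [measurable]: "R \<in> borel_measurable borel" for R :: "real ^ 'n \<Rightarrow> ennreal" and c
  proof -
    have "(\<integral>\<^sup>+\<xi>. weight a (\<xi> - c) * (\<integral>\<^sup>+l. R (l - \<xi>) \<partial>count_space \<Lambda>) \<partial>lborel)
      = (\<integral>\<^sup>+\<xi>. (\<integral>\<^sup>+l. weight a (\<xi> - c) * R (l - \<xi>) \<partial>count_space \<Lambda>) \<partial>lborel)"
      by (simp add: nn_integral_cmult)
    also have "\<dots> = (\<integral>\<^sup>+l. (\<integral>\<^sup>+\<xi>. weight a (\<xi> - c) * R (l - \<xi>) \<partial>lborel) \<partial>count_space \<Lambda>)"
      using \<Lambda> by (intro nn_integral_count_space_nn_integral) auto
    also have "\<dots> = (\<integral>\<^sup>+l. (\<integral>\<^sup>+x. weight a (l - x - c) * R x \<partial>lborel) \<partial>count_space \<Lambda>)"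
    proof (rule nn_integral_cong)
      fix l :: "real ^ 'n"
      have "(\<integral>\<^sup>+\<xi>. weight a (\<xi> - c) * R (l - \<xi>) \<partial>lborel) = (\<integral>\<^sup>+x. weight a ((l - x) - c) * R (l - (l - x)) \<partial>lborel)"
        by (rule nn_integral_lborel_reflect[symmetric]) auto
      then show "(\<integral>\<^sup>+\<xi>. weight a (\<xi> - c) * R (l - \<xi>) \<partial>lborel) = (\<integral>\<^sup>+x. weight a (l - x - c) * R x \<partial>lborel)"
        by simp
    qed
    finally show ?thesis .
  qed
  have shift: "(\<integral>\<^sup>+\<xi>. weight a (\<xi> - c) * (r::ennreal) \<partial>lborel) = w * r" for c :: "real ^ 'n" and r
  proof -
    have "(\<integral>\<^sup>+\<xi>. ennreal (weight a (\<xi> - c)) \<partial>lborel) = w"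
      unfolding w_def uminus_add_conv_diff[symmetric]
      by (rule nn_integral_lborel_shift[of "\<lambda>x. ennreal (weight a x)" "-c"]) auto
    then show ?thesis by (simp add: nn_integral_multc)
  qed
  have upper: "W c * \<kappa> \<le> q * w" for c
  proof -
    have "W c * \<kappa> = (\<integral>\<^sup>+l. weight a (l - c) * \<kappa> \<partial>count_space \<Lambda>)"
      by (simp add: W_def nn_integral_multc)
    also have "\<dots> = (\<integral>\<^sup>+l. (\<integral>\<^sup>+x. weight a (l - c) * (weight a x * Q x) \<partial>lborel) \<partial>count_space \<Lambda>)"
      by (simp add: \<kappa>_def nn_integral_cmult)
    also have "\<dots> \<le> (\<integral>\<^sup>+l. (\<integral>\<^sup>+x. weight a (l - x - c) * Q x \<partial>lborel) \<partial>count_space \<Lambda>)"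
    proof -
      have "ennreal (weight a (l - c)) * (ennreal (weight a x) * Q x) \<le> ennreal (weight a (l - x - c)) * Q x" for l x
      proof -
        have "ennreal (weight a (l - c)) * ennreal (weight a x) \<le> ennreal (weight a (l - x - c))"
        using weight_diff[of a "l - c" x] a
        by (auto simp flip: ennreal_mult intro!: ennreal_leI simp: algebra_simps)
      from mult_right_mono[OF this, of "Q x"]
      show ?thesis by (simp add: mult.assoc)
      qed
      then show ?thesis by (intro nn_integral_mono)
    qed
    also have "\<dots> = (\<integral>\<^sup>+\<xi>. weight a (\<xi> - c) * (\<integral>\<^sup>+l. Q (l - \<xi>) \<partial>count_space \<Lambda>) \<partial>lborel)"
      by (rule J[symmetric]) auto
    also have "\<dots> \<le> (\<integral>\<^sup>+\<xi>. weight a (\<xi> - c) * q \<partial>lborel)"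
      by (intro nn_integral_mono mult_left_mono Q) auto
    finally show ?thesis unfolding shift mult.commute[of w] .
  qed
  have "p * w = (\<integral>\<^sup>+\<xi>. weight a (\<xi> - (0 :: real ^ 'n)) * p \<partial>lborel)"
    unfolding shift by (rule mult.commute)
  also have "\<dots> \<le> (\<integral>\<^sup>+\<xi>. weight a (\<xi> - 0) * (\<integral>\<^sup>+l. P (l - \<xi>) \<partial>count_space \<Lambda>) \<partial>lborel)"
    by (intro nn_integral_mono mult_left_mono P) auto
  also have "\<dots> = (\<integral>\<^sup>+l. (\<integral>\<^sup>+x. weight a (l - x - 0) * P x \<partial>lborel) \<partial>count_space \<Lambda>)"
    by (rule J) auto
  also have "\<dots> = (\<integral>\<^sup>+x. (\<integral>\<^sup>+l. weight a (l - x - 0) * P x \<partial>count_space \<Lambda>) \<partial>lborel)"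
    using \<Lambda> by (intro nn_integral_count_space_nn_integral[symmetric]) auto
  also have "\<dots> = (\<integral>\<^sup>+x. W x * P x \<partial>lborel)"
    by (simp add: W_def nn_integral_multc)
  also have "\<dots> \<le> (\<integral>\<^sup>+x. (SUP c. W c) * P x \<partial>lborel)"
    by (intro nn_integral_mono mult_right_mono SUP_upper) auto
  also have "\<dots> = (SUP c. W c) * (\<integral>\<^sup>+x. P x \<partial>lborel)"
    by (rule nn_integral_cmult) auto
  finally have lower: "p * w \<le> (SUP c. W c) * (\<integral>\<^sup>+x. P x \<partial>lborel)" .
  have "w * (p * \<kappa>) = (p * w) * \<kappa>" by (simp add: mult_ac)
  also have "\<dots> \<le> (SUP c. W c) * (\<integral>\<^sup>+x. P x \<partial>lborel) * \<kappa>"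
    by (intro mult_right_mono lower) auto
  also have "\<dots> = (SUP c. W c) * \<kappa> * (\<integral>\<^sup>+x. P x \<partial>lborel)"
    by (simp only: mult_ac)
  also have "(SUP c. W c) * \<kappa> = (SUP c. W c * \<kappa>)"
    by (rule SUP_mult_right_ennreal)
  also have "\<dots> * (\<integral>\<^sup>+x. P x \<partial>lborel) \<le> (q * w) * (\<integral>\<^sup>+x. P x \<partial>lborel)"
    by (intro mult_right_mono SUP_least upper) auto
  finally have "w * (p * \<kappa>) \<le> w * (q * (\<integral>\<^sup>+x. P x \<partial>lborel))" by (simp add: mult_ac)
  then show ?thesis
    unfolding \<kappa>_def using w by (subst (asm) ennreal_mult_le_mult_iff) (auto simp: less_top)
qed

text \<open>As the parameter of the weight decreases to \<open>0\<close>, the weight increases to \<open>1\<close> and drops out by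
monotone convergence.\<close>

lemma translate_sum_comparison:
  fixes \<Lambda> :: "(real ^ 'n) set" and P Q :: "real ^ 'n \<Rightarrow> ennreal"
  assumes \<Lambda>: "countable \<Lambda>"
    and [measurable]: "P \<in> borel_measurable borel" "Q \<in> borel_measurable borel"
    and P: "\<And>\<xi>. p \<le> (\<integral>\<^sup>+l. P (l - \<xi>) \<partial>count_space \<Lambda>)"
    and Q: "\<And>\<xi>. (\<integral>\<^sup>+l. Q (l - \<xi>) \<partial>count_space \<Lambda>) \<le> q"
  shows "p * (\<integral>\<^sup>+x. Q x \<partial>lborel) \<le> q * (\<integral>\<^sup>+x. P x \<partial>lborel)"
proof -
  let ?v = "\<lambda>(n::nat) x. ennreal (weight (1 / Suc n) x) * Q x"
  have "(SUP n. ?v n x) = Q x" for x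
  proof -
    have "incseq (\<lambda>n. ennreal (weight (1 / Suc n) x))"
      by (intro incseq_SucI ennreal_leI weight_antimono) (simp add: frac_le)
    moreover have "(\<lambda>n. ennreal (weight (1 / Suc n) x)) \<longlonglongrightarrow> ennreal 1"
    proof (intro tendsto_ennrealI)
      have "(\<lambda>n. exp (- (1 / real (Suc n)) * (\<Sum>i\<in>UNIV. \<bar>x $ i\<bar>))) \<longlonglongrightarrow> exp (- 0 * (\<Sum>i\<in>UNIV. \<bar>x $ i\<bar>))"
        by (intro tendsto_intros LIMSEQ_Suc[OF lim_1_over_n])
      then show "(\<lambda>n. weight (1 / real (Suc n)) x) \<longlonglongrightarrow> 1" by (simp add: weight_def)
    qed
    ultimately have "(SUP n. ennreal (weight (1 / Suc n) x)) = 1"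
      using LIMSEQ_SUP LIMSEQ_unique by fastforce
    then show ?thesis by (simp add: SUP_mult_right_ennreal[symmetric])
  qed
  then have "(\<integral>\<^sup>+x. Q x \<partial>lborel) = (\<integral>\<^sup>+x. (SUP n. ?v n x) \<partial>lborel)" by simp
  also have "\<dots> = (SUP n. \<integral>\<^sup>+x. ?v n x \<partial>lborel)"
  proof (rule nn_integral_monotone_convergence_SUP)
    show "incseq ?v"
    proof (intro incseq_SucI le_funI mult_right_mono ennreal_leI)
      show "weight (1 / Suc n) x \<le> weight (1 / Suc (Suc n)) x" for n and x :: "real ^ 'n"
        by (intro weight_antimono) (simp add: frac_le)
    qed auto
  qed auto
  finally have "p * (\<integral>\<^sup>+x. Q x \<partial>lborel) = (SUP n. p * (\<integral>\<^sup>+x. ?v n x \<partial>lborel))"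
    by (simp add: SUP_mult_left_ennreal)
  also have "\<dots> \<le> q * (\<integral>\<^sup>+x. P x \<partial>lborel)"
    by (intro SUP_least translate_sum_comparison_weight[OF \<Lambda> _ _ P Q]) auto
  finally show ?thesis .
qed

section \<open>Plancherel for functions supported in a cube\<close>

lemma nn_integral_fourier_lattice:
  fixes g :: "real ^ 'n \<Rightarrow> complex"
  assumes L: "L > 0" and g: "g \<in> borel_measurable borel"
    and int: "integrable lborel (\<lambda>x. (norm (g x))\<^sup>2)"
    and supp: "\<And>x. x \<notin> cube L \<Longrightarrow> g x = 0"
  shows "(\<integral>\<^sup>+k. ennreal ((norm (fourier g (lattice_point L k)))\<^sup>2) \<partial>count_space UNIV) =
      ennreal (L ^ CARD('n)) * (\<integral>\<^sup>+x. ennreal ((norm (g x))\<^sup>2) \<partial>lborel)"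
proof -
  note * = has_sum_fourier_lattice[OF assms]
  show ?thesis
    using L infsumI[OF *] nn_integral_count_space_infsum[OF has_sum_imp_summable[OF *]]
    by (simp add: ennreal_mult nn_integral_eq_integral[OF int])
qed

text \<open>The translates of the half-open cell by the points of the lattice tile the space: \<open>x\<close> lies in the
cell of the lattice point \<open>k\<close> with \<open>k i = \<lfloor>L * x i\<rfloor>\<close>.\<close>

lemma nn_integral_lattice_cells:
  fixes h :: "real ^ 'n \<Rightarrow> ennreal"
  assumes L: "L > 0" and [measurable]: "h \<in> borel_measurable borel"
  shows "(\<integral>\<^sup>+x. h x \<partial>lborel) =
    (\<integral>\<^sup>+x. (\<integral>\<^sup>+k. h (lattice_point L k + x) \<partial>count_space UNIV) * indicator {x. \<forall>i. 0 \<le> x $ i \<and> x $ i < 1 / L} x \<partial>lborel)"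
proof -
  let ?C = "{x :: real ^ 'n. \<forall>i. 0 \<le> x $ i \<and> x $ i < 1 / L}"
  let ?p = "lattice_point L :: int ^ 'n \<Rightarrow> real ^ 'n"
  have [measurable]: "?C \<in> sets borel" by measurable
  have one: "(\<integral>\<^sup>+k. indicator ?C (x - ?p k) \<partial>count_space UNIV) = (1 :: ennreal)" for x
  proof -
    have "x - ?p k \<in> ?C \<longleftrightarrow> k = (\<chi> i. \<lfloor>L * x $ i\<rfloor>)" for k
    proof -
      have "0 \<le> x $ i - of_int (k $ i) / L \<and> x $ i - of_int (k $ i) / L < 1 / L \<longleftrightarrow> k $ i = \<lfloor>L * x $ i\<rfloor>" for i
      proof -
        have "x $ i - of_int (k $ i) / L = (L * x $ i - of_int (k $ i)) / L" using L by (simp add: field_simps)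
        moreover have "0 \<le> t / L \<and> t / L < 1 / L \<longleftrightarrow> 0 \<le> t \<and> t < 1" for t
          using L by (simp add: zero_le_divide_iff divide_less_cancel)
        moreover have "k $ i = \<lfloor>L * x $ i\<rfloor> \<longleftrightarrow> 0 \<le> L * x $ i - of_int (k $ i) \<and> L * x $ i - of_int (k $ i) < 1"
          by linarith
        ultimately show ?thesis by simp
      qed
      then show ?thesis by (auto simp: lattice_point_def vec_eq_iff)
    qed
    then have "(indicator ?C (x - ?p k) :: ennreal) = indicator {\<chi> i. \<lfloor>L * x $ i\<rfloor>} k" for k
      by (simp add: indicator_def)
    then show ?thesis by simp
  qed
  have "(\<integral>\<^sup>+x. h x \<partial>lborel) = (\<integral>\<^sup>+x. (\<integral>\<^sup>+k. h x * indicator ?C (x - ?p k) \<partial>count_space UNIV) \<partial>lborel)"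
    by (simp add: nn_integral_cmult one)
  also have "\<dots> = (\<integral>\<^sup>+k. (\<integral>\<^sup>+x. h x * indicator ?C (x - ?p k) \<partial>lborel) \<partial>count_space UNIV)"
    by (intro nn_integral_count_space_nn_integral) auto
  also have "\<dots> = (\<integral>\<^sup>+k. (\<integral>\<^sup>+x. h (?p k + x) * indicator ?C x \<partial>lborel) \<partial>count_space UNIV)"
  proof (rule nn_integral_cong)
    fix k
    show "(\<integral>\<^sup>+x. h x * indicator ?C (x - ?p k) \<partial>lborel) = (\<integral>\<^sup>+x. h (?p k + x) * indicator ?C x \<partial>lborel)"
      using nn_integral_lborel_shift[of "\<lambda>x. h x * indicator ?C (x - ?p k)" "?p k"] by simp
  qed
  also have "\<dots> = (\<integral>\<^sup>+x. (\<integral>\<^sup>+k. h (?p k + x) * indicator ?C x \<partial>count_space UNIV) \<partial>lborel)"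
    by (intro nn_integral_count_space_nn_integral[symmetric]) auto
  finally show ?thesis by (simp add: nn_integral_multc)
qed

lemma emeasure_lattice_cell:
  assumes L: "L > 0"
  shows "emeasure lborel {x :: real ^ 'n. \<forall>i. 0 \<le> x $ i \<and> x $ i < 1 / L} = ennreal (1 / L ^ CARD('n))"
proof -
  let ?C = "{x :: real ^ 'n. \<forall>i. 0 \<le> x $ i \<and> x $ i < 1 / L}"
  have [measurable]: "?C \<in> sets borel" by measurable
  have ind: "indicator ?C x = (\<Prod>b\<in>Basis. indicator {0..<1/L} (x \<bullet> b) :: ennreal)" for x
  proof -
    have "x \<in> ?C \<longleftrightarrow> (\<forall>b\<in>Basis. x \<bullet> b \<in> {0..<1/L})"
      by (auto simp: Basis_vec_def inner_axis)
    moreover have "(\<Prod>b\<in>Basis. indicator {0..<1/L} (x \<bullet> b)) =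
        (if \<forall>b\<in>Basis. x \<bullet> b \<in> {0..<1/L} then 1 else 0 :: ennreal)"
      by (auto intro!: prod.neutral prod_zero bexI simp: indicator_def simp del: atLeastLessThan_iff)
    ultimately show ?thesis by (simp add: indicator_def)
  qed
  have "emeasure lborel ?C = (\<integral>\<^sup>+x. indicator ?C x \<partial>lborel)" by simp
  also have "\<dots> = (\<integral>\<^sup>+x. (\<Prod>b\<in>(Basis :: (real ^ 'n) set). indicator {0..<1/L} (x \<bullet> b)) \<partial>lborel)"
    by (simp only: ind)
  also have "\<dots> = (\<Prod>b\<in>(Basis :: (real ^ 'n) set). (\<integral>\<^sup>+t. indicator {0..<1/L} t \<partial>lborel))"
    by (rule nn_integral_lborel_prod) auto
  also have "\<dots> = ennreal (1 / L ^ CARD('n))"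
    using L by (simp add: ennreal_power power_divide)
  finally show ?thesis .
qed

lemma fourier_measurable [measurable]:
  assumes [measurable]: "g \<in> borel_measurable borel"
  shows "fourier g \<in> borel_measurable borel"
proof -
  have "continuous_on UNIV (\<lambda>p::(real ^ 'a) \<times> (real ^ 'a). cnj (character (fst p) (snd p)))"
    unfolding character_def by (intro continuous_intros)
  then have "(\<lambda>p::(real ^ 'a) \<times> (real ^ 'a). cnj (character (fst p) (snd p))) \<in> borel_measurable borel"
    by (rule borel_measurable_continuous_onI)
  then have [measurable]: "(\<lambda>p::(real ^ 'a) \<times> (real ^ 'a). cnj (character (fst p) (snd p))) \<in> borel_measurable (borel \<Otimes>\<^sub>M borel)"
    by (simp add: borel_prod)
  have "(\<lambda>p. g (snd p) * cnj (character (fst p) (snd p))) \<in> borel_measurable (borel \<Otimes>\<^sub>M lborel)"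
    by measurable
  from lborel.borel_measurable_lebesgue_integral[of "\<lambda>l x. g x * cnj (character l x)" borel] this
  show ?thesis by (simp add: fourier_def[abs_def] case_prod_beta')
qed

text \<open>Translating the transform by \<open>l\<close> amounts to multiplying \<open>g\<close> by a character, which does not change
\<open>\<bar>g\<bar>\<close>. So the sum of \<open>\<bar>fourier g\<bar>\<^sup>2\<close> over every translate of the lattice has the value given by Parseval's
identity, and the integral is this value times the volume of a cell.\<close>

lemma plancherel_cube:
  fixes g :: "real ^ 'n \<Rightarrow> complex"
  assumes L: "L > 0" and g [measurable]: "g \<in> borel_measurable borel"
    and int: "integrable lborel (\<lambda>x. (norm (g x))\<^sup>2)"
    and supp: "\<And>x. x \<notin> cube L \<Longrightarrow> g x = 0"
  shows "(\<integral>\<^sup>+l. ennreal ((norm (fourier g l))\<^sup>2) \<partial>lborel) = (\<integral>\<^sup>+x. ennreal ((norm (g x))\<^sup>2) \<partial>lborel)"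
proof -
  let ?C = "{x :: real ^ 'n. \<forall>i. 0 \<le> x $ i \<and> x $ i < 1 / L}"
  let ?I = "\<integral>\<^sup>+x. ennreal ((norm (g x))\<^sup>2) \<partial>lborel"
  have [measurable]: "?C \<in> sets borel" by measurable
  have slice: "(\<integral>\<^sup>+k. ennreal ((norm (fourier g (lattice_point L k + l)))\<^sup>2) \<partial>count_space UNIV)
      = ennreal (L ^ CARD('n)) * ?I" for l
  proof -
    have "fourier g (lattice_point L k + l) = fourier (\<lambda>x. g x * cnj (character l x)) (lattice_point L k)" for k
      by (simp add: fourier_def character_add mult_ac)
    then show ?thesis
      using nn_integral_fourier_lattice[of L "\<lambda>x. g x * cnj (character l x)"] L int supp
      by (simp add: norm_mult)
  qed
  have "(\<integral>\<^sup>+l. ennreal ((norm (fourier g l))\<^sup>2) \<partial>lborel) =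
      (\<integral>\<^sup>+l. ennreal (L ^ CARD('n)) * ?I * indicator ?C l \<partial>lborel)"
    by (subst nn_integral_lattice_cells[OF L]) (auto simp: slice)
  also have "\<dots> = ennreal (L ^ CARD('n)) * ?I * ennreal (1 / L ^ CARD('n))"
    by (subst nn_integral_cmult_indicator) (auto simp: emeasure_lattice_cell[OF L])
  also have "\<dots> = (ennreal (L ^ CARD('n)) * ennreal (1 / L ^ CARD('n))) * ?I" by (simp only: mult_ac)
  also have "ennreal (L ^ CARD('n)) * ennreal (1 / L ^ CARD('n)) = 1"
    using L by (simp flip: ennreal_mult)
  finally show ?thesis by simp
qed

lemma exp_eq_cnj_character:
  "exp (- 2 * complex_of_real pi * \<i> * complex_of_real (l \<bullet> x)) = cnj (character l x)"
  by (simp add: character_def cis_cnj cis_conv_exp exp_cnj mult_ac)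

lemma fourier_coeff_density:
  fixes \<phi> :: "real ^ 'n \<Rightarrow> real"
  assumes [measurable]: "\<phi> \<in> borel_measurable borel" "f \<in> borel_measurable borel" "g \<in> borel_measurable borel"
    and nn: "AE x in lborel. 0 \<le> \<phi> x" and eq: "AE x in lborel. g x = \<phi> x *\<^sub>R f x"
  shows "fourier_coeff (density lborel (\<lambda>x. ennreal (\<phi> x))) f l = fourier g l"
proof -
  have "fourier_coeff (density lborel (\<lambda>x. ennreal (\<phi> x))) f l = (\<integral>x. \<phi> x *\<^sub>R (f x * cnj (character l x)) \<partial>lborel)"
    unfolding fourier_coeff_def exp_eq_cnj_character
    by (rule integral_density) (use nn in auto)
  also have "\<dots> = fourier g l"
    unfolding fourier_def
    by (rule integral_cong_AE) (use eq in \<open>auto elim!: eventually_mono\<close>)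
  finally show ?thesis .
qed

lemma density_zero_outside_support:
  fixes \<phi> :: "real ^ 'n \<Rightarrow> real"
  assumes [measurable]: "\<phi> \<in> borel_measurable borel" and nn: "AE x in lborel. 0 \<le> \<phi> x"
    and \<mu>: "\<mu> = density lborel (\<lambda>x. ennreal (\<phi> x))"
  shows "AE x in lborel. x \<notin> msupport \<mu> \<longrightarrow> \<phi> x = 0"
proof -
  have K [measurable]: "msupport \<mu> \<in> sets borel" by (intro borel_closed closed_msupport)
  have "emeasure \<mu> (- msupport \<mu>) = 0" by (rule emeasure_compl_msupport) (simp add: \<mu>)
  then have "(\<integral>\<^sup>+x. ennreal (\<phi> x) * indicator (- msupport \<mu>) x \<partial>lborel) = 0"
    using K by (subst (asm) (1) \<mu>, subst (asm) emeasure_density) auto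
  then have "AE x in lborel. ennreal (\<phi> x) * indicator (- msupport \<mu>) x = 0"
    by (subst (asm) nn_integral_0_iff_AE) auto
  then show ?thesis using nn by eventually_elim (auto simp: ennreal_eq_0_iff indicator_def)
qed

lemma compact_subset_cube:
  assumes "compact (K :: (real ^ 'n) set)" obtains L where "L > 0" "K \<subseteq> cube L"
proof -
  obtain B where B: "B > 0" "\<And>x. x \<in> K \<Longrightarrow> norm x \<le> B"
    using compact_imp_bounded[OF assms] by (auto simp: bounded_pos)
  have "K \<subseteq> cube (2 * B + 2)"
  proof
    fix x assume "x \<in> K"
    have "\<bar>x $ i\<bar> < (2 * B + 2) / 2" for i
      using B(2)[OF \<open>x \<in> K\<close>] component_le_norm_cart[of x i] by (simp add: field_simps)
    then show "x \<in> cube (2 * B + 2)" unfolding cube_def by blast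
  qed
  then show ?thesis using that[of "2 * B + 2"] B(1) by simp
qed

section \<open>Fourier frames and the density\<close>

text \<open>With \<open>g = \<phi> f\<close>, the square \<open>\<bar>g\<bar>\<^sup>2 = \<phi> (\<phi> \<bar>f\<bar>\<^sup>2)\<close> lies between \<open>m\<close> and \<open>M\<close> times the integrand
\<open>\<phi> \<bar>f\<bar>\<^sup>2\<close> of \<open>\<integral>\<bar>f\<bar>\<^sup>2 d\<mu>\<close>, and Parseval evaluates the sum over the lattice.\<close>

lemma frame_if_density_bounded:
  fixes \<mu> :: "(real ^ 'n) measure" and \<phi> :: "real ^ 'n \<Rightarrow> real"
  assumes \<phi> [measurable]: "\<phi> \<in> borel_measurable borel"
    and nn: "AE x in lborel. 0 \<le> \<phi> x"
    and \<mu>: "\<mu> = density lborel (\<lambda>x. ennreal (\<phi> x))"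
    and K: "compact (msupport \<mu>)"
    and m: "m > 0" and M: "M > 0"
    and bounds: "AE x in lborel. x \<in> msupport \<mu> \<longrightarrow> \<phi> x \<noteq> 0 \<longrightarrow> m \<le> \<phi> x \<and> \<phi> x \<le> M"
  shows "admits_fourier_frame \<mu>"
proof -
  obtain L where L: "L > 0" "msupport \<mu> \<subseteq> cube L" using compact_subset_cube[OF K] .
  have KB [measurable]: "msupport \<mu> \<in> sets borel" by (intro borel_closed closed_msupport)
  have out: "AE x in lborel. x \<notin> msupport \<mu> \<longrightarrow> \<phi> x = 0"
    by (rule density_zero_outside_support[OF \<phi> nn \<mu>])
  let ?p = "lattice_point L :: int ^ 'n \<Rightarrow> real ^ 'n"
  have inj: "inj ?p" using L(1) by (auto simp: inj_def lattice_point_def vec_eq_iff)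
  define V where "V = L ^ CARD('n)"
  have V: "V > 0" using L by (simp add: V_def)
  have key: "(\<lambda>l. (norm (fourier_coeff \<mu> f l))\<^sup>2) summable_on range ?p \<and>
      V * m * (\<integral>x. (norm (f x))\<^sup>2 \<partial>\<mu>) \<le> (\<Sum>\<^sub>\<infinity>l\<in>range ?p. (norm (fourier_coeff \<mu> f l))\<^sup>2) \<and>
      (\<Sum>\<^sub>\<infinity>l\<in>range ?p. (norm (fourier_coeff \<mu> f l))\<^sup>2) \<le> V * M * (\<integral>x. (norm (f x))\<^sup>2 \<partial>\<mu>)"
    if f: "f \<in> L2 \<mu>" for f
  proof -
    have fm [measurable]: "f \<in> borel_measurable borel" using L2D(1)[OF f] by (simp add: \<mu>)
    \<comment> \<open>Cutting off at the support changes \<open>\<phi> f\<close> only on a null set and makes it vanish outside the cube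
    everywhere.\<close>
    define g where "g x = (if x \<in> msupport \<mu> then \<phi> x *\<^sub>R f x else 0)" for x
    have [measurable]: "g \<in> borel_measurable borel" unfolding g_def by measurable
    have fI: "integrable lborel (\<lambda>x. \<phi> x * (norm (f x))\<^sup>2)"
      using L2D(2)[OF f] nn unfolding \<mu> by (subst (asm) integrable_density) auto
    have I: "(\<integral>x. (norm (f x))\<^sup>2 \<partial>\<mu>) = (\<integral>x. \<phi> x * (norm (f x))\<^sup>2 \<partial>lborel)"
      using nn unfolding \<mu> by (subst integral_density) auto
    have gb: "AE x in lborel. m * (\<phi> x * (norm (f x))\<^sup>2) \<le> (norm (g x))\<^sup>2 \<and> (norm (g x))\<^sup>2 \<le> M * (\<phi> x * (norm (f x))\<^sup>2)"
      using nn out bounds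
    proof eventually_elim
      fix x assume *: "0 \<le> \<phi> x" "x \<notin> msupport \<mu> \<longrightarrow> \<phi> x = 0"
        "x \<in> msupport \<mu> \<longrightarrow> \<phi> x \<noteq> 0 \<longrightarrow> m \<le> \<phi> x \<and> \<phi> x \<le> M"
      show "m * (\<phi> x * (norm (f x))\<^sup>2) \<le> (norm (g x))\<^sup>2 \<and> (norm (g x))\<^sup>2 \<le> M * (\<phi> x * (norm (f x))\<^sup>2)"
      proof (cases "\<phi> x = 0")
        case False
        then have b: "m \<le> \<phi> x" "\<phi> x \<le> M" and "x \<in> msupport \<mu>" using * by auto
        then have "(norm (g x))\<^sup>2 = \<phi> x * (\<phi> x * (norm (f x))\<^sup>2)"
          by (simp add: g_def power_mult_distrib power2_eq_square)
        then show ?thesis using b *(1) by (auto intro!: mult_right_mono)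
      qed (simp add: g_def)
    qed
    then have lo: "AE x in lborel. m * (\<phi> x * (norm (f x))\<^sup>2) \<le> (norm (g x))\<^sup>2"
      and hi: "AE x in lborel. (norm (g x))\<^sup>2 \<le> M * (\<phi> x * (norm (f x))\<^sup>2)"
      by auto
    have gI: "integrable lborel (\<lambda>x. (norm (g x))\<^sup>2)"
      by (rule Bochner_Integration.integrable_bound[where f="\<lambda>x. M * (\<phi> x * (norm (f x))\<^sup>2)"])
         (use fI hi in \<open>auto elim!: eventually_mono intro: order.trans[OF _ abs_ge_self]\<close>)
    have coeff: "fourier_coeff \<mu> f l = fourier g l" for l
      unfolding \<mu>
    proof (rule fourier_coeff_density)
      show "AE x in lborel. g x = \<phi> x *\<^sub>R f x" using out by eventually_elim (auto simp: g_def)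
    qed (use nn in auto)
    have sum: "((\<lambda>k. (norm (fourier g (?p k)))\<^sup>2) has_sum (V * (\<integral>x. (norm (g x))\<^sup>2 \<partial>lborel))) UNIV"
      unfolding V_def by (rule has_sum_fourier_lattice[OF L(1)]) (use L gI in \<open>auto simp: g_def\<close>)
    then have sum': "((\<lambda>l. (norm (fourier_coeff \<mu> f l))\<^sup>2) has_sum (V * (\<integral>x. (norm (g x))\<^sup>2 \<partial>lborel))) (range ?p)"
      unfolding coeff by (subst has_sum_reindex[OF inj]) (simp add: o_def)
    have "m * (\<integral>x. \<phi> x * (norm (f x))\<^sup>2 \<partial>lborel) \<le> (\<integral>x. (norm (g x))\<^sup>2 \<partial>lborel)"
      unfolding integral_mult_right_zero[symmetric]
      by (rule integral_mono_AE) (use fI gI lo hi in auto)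
    moreover have "(\<integral>x. (norm (g x))\<^sup>2 \<partial>lborel) \<le> M * (\<integral>x. \<phi> x * (norm (f x))\<^sup>2 \<partial>lborel)"
      unfolding integral_mult_right_zero[symmetric]
      by (rule integral_mono_AE) (use fI gI lo hi in auto)
    ultimately show ?thesis
      using has_sum_imp_summable[OF sum'] V by (simp add: infsumI[OF sum'] I mult.assoc)
  qed
  have "is_fourier_frame \<mu> (range ?p)"
    unfolding is_fourier_frame_def using key V m M
    by (intro exI[of _ "V * m"] conjI exI[of _ "V * M"] ballI) auto
  moreover have "countable (range ?p)" by (rule countable_image) simp
  ultimately show ?thesis unfolding admits_fourier_frame_def by (intro exI[of _ "range ?p"] conjI)
qed

text \<open>Let \<open>S\<close> and \<open>T\<close> be the two level sets. The functions \<open>1\<^sub>X * character \<xi>\<close> for \<open>X = S\<close> and \<open>X = T\<close> have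
squared norm \<open>\<mu> X\<close> for all \<open>\<xi>\<close>, and their coefficients are the translates by \<open>\<xi>\<close> of the transform of \<open>\<phi> 1\<^sub>X\<close>. Comparing the
sums of the translates and applying Plancherel gives \<open>A \<mu>(S) \<integral>\<^sub>T \<phi>\<^sup>2 \<le> B \<mu>(T) \<integral>\<^sub>S \<phi>\<^sup>2\<close>, and here
\<open>\<integral>\<^sub>T \<phi>\<^sup>2 \<ge> t \<mu>(T)\<close> and \<open>\<integral>\<^sub>S \<phi>\<^sup>2 \<le> s \<mu>(S)\<close>. The bound \<open>u\<close> on \<open>T\<close> ensures that
\<open>\<phi> 1\<^sub>T\<close> is square-integrable.\<close>

lemma frame_level_set_comparison:
  fixes \<mu> :: "(real ^ 'n) measure" and \<phi> :: "real ^ 'n \<Rightarrow> real"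
  assumes prob: "prob_space \<mu>"
    and \<phi> [measurable]: "\<phi> \<in> borel_measurable borel"
    and nn: "AE x in lborel. 0 \<le> \<phi> x"
    and \<mu>: "\<mu> = density lborel (\<lambda>x. ennreal (\<phi> x))"
    and K: "compact (msupport \<mu>)"
    and \<Lambda>: "countable \<Lambda>" and A: "A > 0" and B: "B > 0"
    and frame: "\<And>f. f \<in> L2 \<mu> \<Longrightarrow> (\<lambda>l. (norm (fourier_coeff \<mu> f l))\<^sup>2) summable_on \<Lambda> \<and>
      A * (\<integral>x. (norm (f x))\<^sup>2 \<partial>\<mu>) \<le> (\<Sum>\<^sub>\<infinity>l\<in>\<Lambda>. (norm (fourier_coeff \<mu> f l))\<^sup>2) \<and>
      (\<Sum>\<^sub>\<infinity>l\<in>\<Lambda>. (norm (fourier_coeff \<mu> f l))\<^sup>2) \<le> B * (\<integral>x. (norm (f x))\<^sup>2 \<partial>\<mu>)"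
    and st: "s \<ge> 0" "t \<ge> 0"
    and pos: "emeasure \<mu> {x. 0 < \<phi> x \<and> \<phi> x \<le> s} > 0" "emeasure \<mu> {x. t \<le> \<phi> x \<and> \<phi> x \<le> u} > 0"
  shows "A * t \<le> B * s"
proof -
  interpret prob_space \<mu> by (rule prob)
  have sets [measurable_cong]: "sets \<mu> = sets borel" by (simp add: \<mu>)
  obtain L where L: "L > 0" "msupport \<mu> \<subseteq> cube L" using compact_subset_cube[OF K] .
  have KB [measurable]: "msupport \<mu> \<in> sets borel" by (intro borel_closed closed_msupport)
  have out: "AE x in lborel. x \<notin> msupport \<mu> \<longrightarrow> \<phi> x = 0"
    by (rule density_zero_outside_support[OF \<phi> nn \<mu>])
  define g where "g X x = (if x \<in> X \<inter> msupport \<mu> then complex_of_real (\<phi> x) else 0)" for X x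
  define P where "P X l = ennreal ((norm (fourier (g X) l))\<^sup>2)" for X l
  define S where "S = {x. 0 < \<phi> x \<and> \<phi> x \<le> s}"
  define T where "T = {x. t \<le> \<phi> x \<and> \<phi> x \<le> u}"
  have ST [measurable]: "S \<in> sets borel" "T \<in> sets borel" unfolding S_def T_def by measurable
  have gm [measurable]: "g X \<in> borel_measurable borel" if [measurable]: "X \<in> sets borel" for X
    unfolding g_def by measurable
  have Pm: "P X \<in> borel_measurable borel" if [measurable]: "X \<in> sets borel" for X
    unfolding P_def by measurable
  have meas_eq: "emeasure \<mu> X = (\<integral>\<^sup>+x. ennreal (\<phi> x) * indicator X x \<partial>lborel)" if "X \<in> sets borel" for X
    unfolding \<mu> using that by (subst emeasure_density) auto
  have frameX: "ennreal (A * measure \<mu> X) \<le> (\<integral>\<^sup>+l. P X (l - \<xi>) \<partial>count_space \<Lambda>) \<and>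
     (\<integral>\<^sup>+l. P X (l - \<xi>) \<partial>count_space \<Lambda>) \<le> ennreal (B * measure \<mu> X)" if X [measurable]: "X \<in> sets borel" for X \<xi>
  proof -
    let ?f = "\<lambda>x. indicator X x * character \<xi> x"
    have fL2: "?f \<in> L2 \<mu>"
      by (rule L2_bounded[where c=1]) (auto simp: indicator_def)
    have "(norm (?f x))\<^sup>2 = indicator X x" for x by (simp add: indicator_def)
    then have norm: "(\<integral>x. (norm (?f x))\<^sup>2 \<partial>\<mu>) = measure \<mu> X" by simp
    have coeff: "fourier_coeff \<mu> ?f l = fourier (g X) (l - \<xi>)" for l
    proof -
      have "fourier_coeff \<mu> ?f l = fourier (\<lambda>x. g X x * character \<xi> x) l"
        unfolding \<mu>
      proof (rule fourier_coeff_density)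
        show "AE x in lborel. g X x * character \<xi> x = \<phi> x *\<^sub>R (indicator X x * character \<xi> x)"
          using out by eventually_elim (auto simp: g_def indicator_def scaleR_conv_of_real)
      qed (use nn in auto)
      also have "\<dots> = fourier (g X) (l - \<xi>)"
        using character_add[of l "-\<xi>"] by (simp add: fourier_def character_minus mult_ac)
      finally show ?thesis .
    qed
    have "(\<integral>\<^sup>+l. P X (l - \<xi>) \<partial>count_space \<Lambda>) = ennreal (\<Sum>\<^sub>\<infinity>l\<in>\<Lambda>. (norm (fourier_coeff \<mu> ?f l))\<^sup>2)"
      unfolding P_def coeff[symmetric]
      by (rule nn_integral_count_space_infsum) (use frame[OF fL2] in auto)
    then show ?thesis using frame[OF fL2] by (auto simp: norm intro!: ennreal_leI)
  qed
  have planch: "(\<integral>\<^sup>+l. P X l \<partial>lborel) = (\<integral>\<^sup>+x. ennreal ((\<phi> x)\<^sup>2) * indicator X x \<partial>lborel)"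
    if X [measurable]: "X \<in> sets borel" and b: "\<And>x. x \<in> X \<Longrightarrow> \<bar>\<phi> x\<bar> \<le> c" for X c
  proof -
    have int: "integrable lborel (\<lambda>x. (norm (g X x))\<^sup>2)"
    proof (rule Bochner_Integration.integrable_bound[where f="\<lambda>x. c\<^sup>2 * indicator (cube L) x"])
      show "integrable lborel (\<lambda>x. c\<^sup>2 * indicator (cube L :: (real ^ 'n) set) x :: real)"
        using emeasure_cube[OF L(1), where 'n='n] by (intro integrable_mult_right) auto
      show "AE x in lborel. norm ((norm (g X x))\<^sup>2) \<le> norm (c\<^sup>2 * indicator (cube L) x)"
      proof (rule AE_I2)
        fix x
        show "norm ((norm (g X x))\<^sup>2) \<le> norm (c\<^sup>2 * indicator (cube L) x)"
          using b[of x] power_mono[OF b[of x], of 2] L(2) by (auto simp: g_def indicator_def)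
      qed
    qed auto
    have "(\<integral>\<^sup>+l. P X l \<partial>lborel) = (\<integral>\<^sup>+x. ennreal ((norm (g X x))\<^sup>2) \<partial>lborel)"
      unfolding P_def by (rule plancherel_cube[OF L(1) gm[OF X] int]) (use L(2) in \<open>auto simp: g_def\<close>)
    also have "\<dots> = (\<integral>\<^sup>+x. ennreal ((\<phi> x)\<^sup>2) * indicator X x \<partial>lborel)"
      by (rule nn_integral_cong_AE) (use out in eventually_elim, auto simp: g_def indicator_def)
    finally show ?thesis .
  qed
  have upperS: "(\<integral>\<^sup>+l. P S l \<partial>lborel) \<le> ennreal s * emeasure \<mu> S"
  proof -
    have "(\<integral>\<^sup>+l. P S l \<partial>lborel) = (\<integral>\<^sup>+x. ennreal ((\<phi> x)\<^sup>2) * indicator S x \<partial>lborel)"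
      by (rule planch[of S s]) (auto simp: S_def)
    also have "\<dots> \<le> (\<integral>\<^sup>+x. ennreal s * (ennreal (\<phi> x) * indicator S x) \<partial>lborel)"
      by (intro nn_integral_mono)
         (auto simp: S_def indicator_def power2_eq_square simp flip: ennreal_mult intro!: ennreal_leI mult_right_mono)
    also have "\<dots> = ennreal s * emeasure \<mu> S" by (simp add: nn_integral_cmult meas_eq)
    finally show ?thesis .
  qed
  have lowerT: "ennreal t * emeasure \<mu> T \<le> (\<integral>\<^sup>+l. P T l \<partial>lborel)"
  proof -
    have "ennreal t * emeasure \<mu> T = (\<integral>\<^sup>+x. ennreal t * (ennreal (\<phi> x) * indicator T x) \<partial>lborel)"
      by (simp add: nn_integral_cmult meas_eq)
    also have "\<dots> \<le> (\<integral>\<^sup>+x. ennreal ((\<phi> x)\<^sup>2) * indicator T x \<partial>lborel)"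
      by (intro nn_integral_mono)
         (use st in \<open>auto simp: T_def indicator_def power2_eq_square simp flip: ennreal_mult intro!: ennreal_leI mult_right_mono\<close>)
    also have "\<dots> = (\<integral>\<^sup>+l. P T l \<partial>lborel)"
      by (rule planch[of T u, symmetric]) (use st in \<open>auto simp: T_def\<close>)
    finally show ?thesis .
  qed
  have "ennreal (A * measure \<mu> S) * (\<integral>\<^sup>+l. P T l \<partial>lborel) \<le> ennreal (B * measure \<mu> T) * (\<integral>\<^sup>+l. P S l \<partial>lborel)"
    by (rule translate_sum_comparison[OF \<Lambda> Pm Pm]) (use frameX ST in auto)
  also have "\<dots> \<le> ennreal (B * measure \<mu> T) * (ennreal s * emeasure \<mu> S)"
    by (intro mult_left_mono upperS) auto
  finally have "ennreal (A * measure \<mu> S) * (ennreal t * emeasure \<mu> T) \<le> ennreal (B * measure \<mu> T) * (ennreal s * emeasure \<mu> S)"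
    using order.trans[OF mult_left_mono[OF lowerT]] by fastforce
  then have "(A * measure \<mu> S) * (t * measure \<mu> T) \<le> (B * measure \<mu> T) * (s * measure \<mu> S)"
    using A B st by (simp add: emeasure_eq_measure flip: ennreal_mult)
  then have "(A * t) * (measure \<mu> S * measure \<mu> T) \<le> (B * s) * (measure \<mu> S * measure \<mu> T)"
    by (simp add: mult_ac)
  moreover have "measure \<mu> S * measure \<mu> T > 0"
    using pos unfolding S_def[symmetric] T_def[symmetric] by (simp add: emeasure_eq_measure)
  ultimately show ?thesis by (simp add: mult_le_cancel_right)
qed

text \<open>Since \<open>\<mu>\<close> is not zero, some level set \<open>1 / c \<le> \<phi> \<le> c\<close> has positive measure. Comparing it with the
sets where \<open>\<phi>\<close> is very small or very large shows that those are null.\<close>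

lemma density_bounded_if_frame:
  fixes \<mu> :: "(real ^ 'n) measure" and \<phi> :: "real ^ 'n \<Rightarrow> real"
  assumes prob: "prob_space \<mu>"
    and \<phi> [measurable]: "\<phi> \<in> borel_measurable borel"
    and nn: "AE x in lborel. 0 \<le> \<phi> x"
    and \<mu>: "\<mu> = density lborel (\<lambda>x. ennreal (\<phi> x))"
    and K: "compact (msupport \<mu>)"
    and frame: "admits_fourier_frame \<mu>"
  shows "\<exists>m>0. \<exists>M>0. AE x in lborel. \<phi> x \<noteq> 0 \<longrightarrow> m \<le> \<phi> x \<and> \<phi> x \<le> M"
proof -
  interpret prob_space \<mu> by (rule prob)
  have sets [measurable_cong]: "sets \<mu> = sets borel" by (simp add: \<mu>)
  obtain \<Lambda> A B where \<Lambda>: "countable \<Lambda>" and AB: "A > 0" "B > 0"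
    and fr: "\<And>f. f \<in> L2 \<mu> \<Longrightarrow> (\<lambda>l. (norm (fourier_coeff \<mu> f l))\<^sup>2) summable_on \<Lambda> \<and>
      A * (\<integral>x. (norm (f x))\<^sup>2 \<partial>\<mu>) \<le> (\<Sum>\<^sub>\<infinity>l\<in>\<Lambda>. (norm (fourier_coeff \<mu> f l))\<^sup>2) \<and>
      (\<Sum>\<^sub>\<infinity>l\<in>\<Lambda>. (norm (fourier_coeff \<mu> f l))\<^sup>2) \<le> B * (\<integral>x. (norm (f x))\<^sup>2 \<partial>\<mu>)"
    using frame unfolding admits_fourier_frame_def is_fourier_frame_def by blast
  note comparison = frame_level_set_comparison[OF prob \<phi> nn \<mu> K \<Lambda> AB fr]
  have null: "AE x in lborel. \<phi> x > 0 \<longrightarrow> x \<notin> X"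
    if "\<not> emeasure \<mu> X > 0" and [measurable]: "X \<in> sets borel" for X
  proof -
    have "X \<in> null_sets \<mu>" using that by (auto simp: sets zero_less_iff_neq_zero)
    then show ?thesis
      unfolding \<mu> by (auto simp: null_sets_density_iff elim!: eventually_mono)
  qed
  have "\<exists>k. emeasure \<mu> {x. 1 / Suc k \<le> \<phi> x \<and> \<phi> x \<le> Suc k} > 0"
  proof (rule ccontr)
    assume "\<not> ?thesis"
    then have "AE x in lborel. \<forall>k::nat. \<phi> x > 0 \<longrightarrow> x \<notin> {x. 1 / Suc k \<le> \<phi> x \<and> \<phi> x \<le> Suc k}"
      unfolding AE_all_countable by (intro allI null) auto
    then have "AE x in lborel. \<not> \<phi> x > 0"
    proof eventually_elim
      fix x assume *: "\<forall>k::nat. \<phi> x > 0 \<longrightarrow> x \<notin> {x. 1 / Suc k \<le> \<phi> x \<and> \<phi> x \<le> Suc k}"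
      show "\<not> \<phi> x > 0"
      proof
        assume pos: "\<phi> x > 0"
        obtain k :: nat where k: "max (\<phi> x) (1 / \<phi> x) \<le> k" using real_arch_simple by blast
        have "\<phi> x \<le> Suc k" "1 / \<phi> x \<le> Suc k" using k by auto
        then have "1 / Suc k \<le> \<phi> x \<and> \<phi> x \<le> Suc k" using pos by (simp add: field_simps)
        with * pos show False by blast
      qed
    qed
    then have "AE x in \<mu>. False"
      unfolding \<mu> by (subst AE_density) (auto elim!: eventually_mono)
    then show False by simp
  qed
  then obtain k where k: "emeasure \<mu> {x. 1 / Suc k \<le> \<phi> x \<and> \<phi> x \<le> Suc k} > 0" by blast
  define c where "c = real (Suc k)"
  have c: "c > 0" by (simp add: c_def)
  have k: "emeasure \<mu> {x. 1 / c \<le> \<phi> x \<and> \<phi> x \<le> c} > 0" using k by (simp add: c_def)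
  have k': "emeasure \<mu> {x. 0 < \<phi> x \<and> \<phi> x \<le> c} > 0"
  proof -
    have "{x. 1 / c \<le> \<phi> x \<and> \<phi> x \<le> c} \<subseteq> {x. 0 < \<phi> x \<and> \<phi> x \<le> c}"
      using c by (auto intro: less_le_trans[of 0 "1 / c"])
    then show ?thesis by (intro less_le_trans[OF k] emeasure_mono) auto
  qed
  \<comment> \<open>The comparison forces \<open>m \<ge> A / (B c)\<close> and \<open>M \<le> B c / A\<close> if the level sets below \<open>m\<close> and above \<open>M\<close>
  are not null; the factors \<open>2\<close> contradict this.\<close>
  define m where "m = A / (2 * B * c)"
  define M where "M = 2 * B * c / A"
  have mM: "m > 0" "M > 0" using AB c by (auto simp: m_def M_def)
  have "\<not> emeasure \<mu> {x. 0 < \<phi> x \<and> \<phi> x \<le> m} > 0"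
  proof
    assume "emeasure \<mu> {x. 0 < \<phi> x \<and> \<phi> x \<le> m} > 0"
    from comparison[OF _ _ _ this k] have "A * (1 / c) \<le> B * m" using mM c by simp
    then show False using AB c by (simp add: m_def field_simps)
  qed
  then have low: "AE x in lborel. \<phi> x > 0 \<longrightarrow> x \<notin> {x. 0 < \<phi> x \<and> \<phi> x \<le> m}"
    by (intro null) auto
  have "\<not> emeasure \<mu> {x. M \<le> \<phi> x \<and> \<phi> x \<le> real u} > 0" for u :: nat
  proof
    assume "emeasure \<mu> {x. M \<le> \<phi> x \<and> \<phi> x \<le> real u} > 0"
    from comparison[OF _ _ _ k' this] have "A * M \<le> B * c" using mM c by simp
    then show False using AB c by (simp add: M_def field_simps)
  qed
  then have up: "AE x in lborel. \<forall>u::nat. \<phi> x > 0 \<longrightarrow> x \<notin> {x. M \<le> \<phi> x \<and> \<phi> x \<le> real u}"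
    unfolding AE_all_countable by (intro allI null) auto
  have "AE x in lborel. \<phi> x \<noteq> 0 \<longrightarrow> m \<le> \<phi> x \<and> \<phi> x \<le> M"
    using nn low up
  proof eventually_elim
    fix x assume *: "0 \<le> \<phi> x" "\<phi> x > 0 \<longrightarrow> x \<notin> {x. 0 < \<phi> x \<and> \<phi> x \<le> m}"
      "\<forall>u::nat. \<phi> x > 0 \<longrightarrow> x \<notin> {x. M \<le> \<phi> x \<and> \<phi> x \<le> real u}"
    obtain u :: nat where "\<phi> x \<le> real u" using real_arch_simple by blast
    with * show "\<phi> x \<noteq> 0 \<longrightarrow> m \<le> \<phi> x \<and> \<phi> x \<le> M" by auto
  qed
  then show ?thesis using mM by blast
qed

theorem theorem1p1:
  fixes \<mu> :: "(real ^ 'n) measure" and \<phi> :: "real ^ 'n \<Rightarrow> real"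
  assumes "prob_space \<mu>"
    and "\<phi> \<in> borel_measurable lborel"
    and "AE x in lborel. 0 \<le> \<phi> x"
    and "\<mu> = density lborel (\<lambda>x. ennreal (\<phi> x))"
    and "compact (msupport \<mu>)"
  shows "admits_fourier_frame \<mu> \<longleftrightarrow>
    (\<exists>m>0. \<exists>M>0. AE x in lborel. x \<in> msupport \<mu> \<longrightarrow> \<phi> x \<noteq> 0 \<longrightarrow> m \<le> \<phi> x \<and> \<phi> x \<le> M)"
proof
  have \<phi>: "\<phi> \<in> borel_measurable borel" using assms(2) by simp
  show "\<exists>m>0. \<exists>M>0. AE x in lborel. x \<in> msupport \<mu> \<longrightarrow> \<phi> x \<noteq> 0 \<longrightarrow> m \<le> \<phi> x \<and> \<phi> x \<le> M"
    if "admits_fourier_frame \<mu>"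
    using density_bounded_if_frame[OF assms(1) \<phi> assms(3-5) that] by (auto elim!: eventually_mono)
  show "admits_fourier_frame \<mu>"
    if "\<exists>m>0. \<exists>M>0. AE x in lborel. x \<in> msupport \<mu> \<longrightarrow> \<phi> x \<noteq> 0 \<longrightarrow> m \<le> \<phi> x \<and> \<phi> x \<le> M"
    using that frame_if_density_bounded[OF \<phi> assms(3-5)] by blast
qed

end
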